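(* Let $n\ge2$ and let $\mathcal{F}$ be a family of perfect matchings of $K_{2n}$ such that for any two members $x,y\in\mathcal{F}$, the multigraph on vertex set $[2n]$ with edge multiset $x\cup y$ is disconnected. Then $|\mathcal{F}|\le (2(n-1)-1)!!$, and this bound is attained.
   Context: $k!!$ denotes the double factorial. The union $x\cup y$ is taken as a multiset, so a common edge appears twice; $x\cup y$ is connected iff it is a Hamiltonian cycle of $K_{2n}$. *)

theory Defs
  imports Main "HOL-Library.Multiset"
begin

fun double_fact :: "nat \<Rightarrow> nat" where
  "double_fact 0 = 1"
| "double_fact (Suc 0) = 1"
| "double_fact (Suc (Suc k)) = Suc (Suc k) * double_fact k"

definition complete_edges :: "'a set \<Rightarrow> 'a set set" where
  "complete_edges V = {e. e \<subseteq> V \<and> card e = 2}"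

definition perfect_matching :: "'a set \<Rightarrow> 'a set set \<Rightarrow> 'a set set \<Rightarrow> bool" where
  "perfect_matching V E M \<longleftrightarrow> M \<subseteq> E \<and> (\<forall>v\<in>V. \<exists>!e. e \<in> M \<and> v \<in> e)"

definition multigraph_connected :: "'a set \<Rightarrow> 'a set multiset \<Rightarrow> bool" where
  "multigraph_connected V E \<longleftrightarrow>
     V \<noteq> {} \<and> (\<forall>u\<in>V. \<forall>v\<in>V. (u, v) \<in> {(a, b). {a, b} \<in># E}\<^sup>*)"

text \<open>The union of two matchings is the multiset sum, so a common edge occurs twice. Matchings of
  a finite graph are finite, so \<^const>\<open>mset_set\<close> loses nothing.\<close>

definition matching_union :: "'a set set \<Rightarrow> 'a set set \<Rightarrow> 'a set multiset" where
  "matching_union x y = mset_set x + mset_set y"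

text \<open>The pairs with \<open>x = y\<close> are not excluded; for \<open>n \<ge> 2\<close> the multigraph on \<open>[2n]\<close> with edges
  \<open>x \<union> x\<close> consists of \<open>n\<close> doubled edges and is disconnected anyway.\<close>

definition disconnected_matching_family :: "nat \<Rightarrow> nat set set set \<Rightarrow> bool" where
  "disconnected_matching_family n \<F> \<longleftrightarrow>
     (\<forall>x\<in>\<F>. perfect_matching {1..2*n} (complete_edges {1..2*n}) x) \<and>
     (\<forall>x\<in>\<F>. \<forall>y\<in>\<F>. \<not> multigraph_connected {1..2*n} (matching_union x y))"

end

theory Submission
  imports Defs "HOL-Library.FuncSet" "HOL-Combinatorics.Transposition" Complex_Main
begin

text \<open>
  The bound is the ratio bound for the graph \<open>H\<close> on the perfect matchings of \<open>K\<^bsub>2n\<^esub>\<close> in which two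
  matchings are adjacent when their union is a Hamiltonian cycle. \<open>H\<close> is regular of degree
  \<open>(2n-2)!!\<close>, and it suffices that \<open>\<bar>H\<bar> \<le> (2n-4)!!\<close> on the functions with sum \<open>0\<close>.

  Fix a vertex \<open>p\<close> and write a matching as \<open>{p, a} \<union> m\<close>. Contracting \<open>{p, a}\<close> gives
  \<open>H\<^sub>n = H\<^bsub>n-1\<^esub> A\<close>, where \<open>H\<^bsub>n-1\<^esub>\<close> acts on \<open>m\<close> and \<open>(A f)(a, m)\<close> is the sum of
  \<open>f(w, (a w) m)\<close> over \<open>w \<noteq> a\<close>. On functions of \<open>a\<close> alone with sum \<open>0\<close>, \<open>H\<^bsub>n-1\<^esub>\<close> is \<open>(2n-4)!!\<close> and
  \<open>A\<close> is \<open>-1\<close>. On functions whose sum over \<open>m\<close> vanishes for every \<open>a\<close>, \<open>\<bar>H\<^bsub>n-1\<^esub>\<bar> \<le> (2n-6)!!\<close> by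
  induction, and \<open>\<bar>A\<bar> \<le> 2n-4\<close>. The latter is again an induction: after fixing an edge \<open>{b, c}\<close> of
  \<open>m\<close>, the mean over the rest of \<open>m\<close> is a function of \<open>a, b, c\<close>, for which the bound is a sum of
  squares.
\<close>

section \<open>Perfect matchings\<close>

definition pms :: "'a set \<Rightarrow> 'a set set set" where
  "pms S = {x. perfect_matching S (complete_edges S) x}"

definition relabel :: "('a \<Rightarrow> 'a) \<Rightarrow> 'a set set \<Rightarrow> 'a set set" where
  "relabel \<sigma> m = (`) \<sigma> ` m"

lemma pms_edge:
  assumes "x \<in> pms S" "e \<in> x"
  shows "e \<subseteq> S" "card e = 2"
  using assms by (auto simp: pms_def perfect_matching_def complete_edges_def)

lemma pms_covers: "x \<in> pms S \<Longrightarrow> v \<in> S \<Longrightarrow> \<exists>e\<in>x. v \<in> e"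
  by (auto simp: pms_def perfect_matching_def)

lemma pms_unique:
  assumes "x \<in> pms S" "e \<in> x" "e' \<in> x" "v \<in> e" "v \<in> e'"
  shows "e = e'"
proof -
  have "v \<in> S" using pms_edge[OF assms(1,2)] assms(4) by auto
  then show ?thesis using assms by (auto simp: pms_def perfect_matching_def)
qed

lemma pmsI:
  assumes "\<And>e. e \<in> x \<Longrightarrow> e \<subseteq> S \<and> card e = 2"
    and "\<And>v. v \<in> S \<Longrightarrow> \<exists>e\<in>x. v \<in> e"
    and "\<And>e e' v. e \<in> x \<Longrightarrow> e' \<in> x \<Longrightarrow> v \<in> e \<Longrightarrow> v \<in> e' \<Longrightarrow> e = e'"
  shows "x \<in> pms S"
  using assms unfolding pms_def perfect_matching_def complete_edges_def by blast

lemma finite_pms: "finite S \<Longrightarrow> finite (pms S)"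
  by (rule finite_subset[of _ "Pow (Pow S)"]) (auto dest: pms_edge)

lemma finite_pm: "finite S \<Longrightarrow> x \<in> pms S \<Longrightarrow> finite x"
  by (rule finite_subset[of _ "Pow S"]) (auto dest: pms_edge)

lemma pms_empty: "pms {} = {{}}"
  by (auto simp: pms_def perfect_matching_def complete_edges_def)

section \<open>Adding and removing the edge at a fixed vertex\<close>

lemma insert_edge_pms:
  assumes "p \<in> S" "a \<in> S" "p \<noteq> a" "m \<in> pms (S - {p, a})"
  shows "insert {p, a} m \<in> pms S"
proof (rule pmsI)
  fix e assume "e \<in> insert {p, a} m"
  then show "e \<subseteq> S \<and> card e = 2" using assms pms_edge[OF assms(4)] by auto
next
  fix v assume "v \<in> S"
  then show "\<exists>e\<in>insert {p, a} m. v \<in> e"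
    using pms_covers[OF assms(4), of v] by auto
next
  fix e e' v assume "e \<in> insert {p, a} m" "e' \<in> insert {p, a} m" "v \<in> e" "v \<in> e'"
  then show "e = e'"
    using pms_unique[OF assms(4)] pms_edge(1)[OF assms(4)] by blast
qed

lemma remove_edge_pms:
  assumes "x \<in> pms S" "{p, a} \<in> x"
  shows "x - {{p, a}} \<in> pms (S - {p, a})"
proof (rule pmsI)
  fix e assume "e \<in> x - {{p, a}}"
  then show "e \<subseteq> S - {p, a} \<and> card e = 2"
    using pms_edge[OF assms(1), of e] pms_unique[OF assms(1) _ assms(2), of e] by auto
next
  fix v assume "v \<in> S - {p, a}"
  then show "\<exists>e\<in>x - {{p, a}}. v \<in> e" using pms_covers[OF assms(1), of v] by auto
next
  fix e e' v assume "e \<in> x - {{p, a}}" "e' \<in> x - {{p, a}}" "v \<in> e" "v \<in> e'"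
  then show "e = e'" using pms_unique[OF assms(1)] by blast
qed

lemma pms_partner:
  assumes "x \<in> pms S" "p \<in> S"
  shows "\<exists>a\<in>S - {p}. {p, a} \<in> x"
proof -
  obtain e where e: "e \<in> x" "p \<in> e" using pms_covers assms by metis
  moreover obtain u v where "e = {u, v}" "u \<noteq> v"
    using pms_edge(2)[OF assms(1) e(1)] by (meson card_2_iff)
  moreover have "e \<subseteq> S" using pms_edge(1)[OF assms(1) e(1)] .
  ultimately consider a where "e = {p, a}" "a \<in> S - {p}"
    by (metis Diff_iff insert_commute insert_iff singletonD subsetD)
  then show ?thesis using e(1) by (cases; blast)
qed

text \<open>The partner \<open>a\<close> of \<open>p\<close> can be read off from the matching, and
  deleting \<open>{p, a}\<close> leaves an arbitrary perfect matching of the other vertices.\<close>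

lemma bij_betw_insert_edge:
  assumes "p \<in> S"
  shows "bij_betw (\<lambda>(a, m). insert {p, a} m) (SIGMA a:S - {p}. pms (S - {p, a})) (pms S)"
  unfolding bij_betw_def
proof
  have *: "a = a' \<and> m = m'"
    if "a \<in> S - {p}" "m \<in> pms (S - {p, a})" "a' \<in> S - {p}" "m' \<in> pms (S - {p, a'})"
      "insert {p, a} m = insert {p, a'} m'" for a m a' m'
  proof -
    have 1: "{p, a} \<notin> m" "{p, a'} \<notin> m'"
      using pms_edge(1)[OF that(2)] pms_edge(1)[OF that(4)] by auto
    have "insert {p, a} m \<in> pms S"
      by (rule insert_edge_pms) (use assms that in auto)
    moreover have "{p, a'} \<in> insert {p, a} m" unfolding that(5) by simp
    ultimately have "{p, a} = {p, a'}"
      by (elim pms_unique[where v = p]) simp_all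
    then have "a = a'" by (auto simp: doubleton_eq_iff)
    moreover from this have "m = m'"
      using that(5) 1 by (simp add: insert_ident)
    ultimately show ?thesis ..
  qed
  show "inj_on (\<lambda>(a, m). insert {p, a} m) (SIGMA a:S - {p}. pms (S - {p, a}))"
  proof (rule inj_onI)
    fix z z' assume z: "z \<in> (SIGMA a:S - {p}. pms (S - {p, a}))"
      "z' \<in> (SIGMA a:S - {p}. pms (S - {p, a}))"
      "(\<lambda>(a, m). insert {p, a} m) z = (\<lambda>(a, m). insert {p, a} m) z'"
    obtain a m a' m' where "z = (a, m)" "z' = (a', m')" by (cases z, cases z')
    with z *[of a m a' m'] show "z = z'" by simp
  qed
  show "(\<lambda>(a, m). insert {p, a} m) ` (SIGMA a:S - {p}. pms (S - {p, a})) = pms S" (is "?L = _")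
  proof
    show "?L \<subseteq> pms S" using insert_edge_pms[OF assms] by auto
    show "pms S \<subseteq> ?L"
    proof
      fix x assume x: "x \<in> pms S"
      obtain a where a: "a \<in> S - {p}" "{p, a} \<in> x" using pms_partner[OF x assms] by blast
      then have "x = insert {p, a} (x - {{p, a}})" by blast
      moreover have "x - {{p, a}} \<in> pms (S - {p, a})" using remove_edge_pms[OF x a(2)] .
      ultimately show "x \<in> ?L" using a(1) by (intro image_eqI[of _ _ "(a, x - {{p, a}})"]) auto
    qed
  qed
qed

text \<open>This is the recursion behind every induction below: a sum over matchings is split
  according to the partner of a chosen vertex.\<close>

lemma sum_pms_partner:
  fixes \<phi> :: "'a set set \<Rightarrow> 'b :: comm_monoid_add"
  assumes "finite S" "p \<in> S"
  shows "(\<Sum>x\<in>pms S. \<phi> x) = (\<Sum>a\<in>S - {p}. \<Sum>m\<in>pms (S - {p, a}). \<phi> (insert {p, a} m))"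
proof -
  have "(\<Sum>x\<in>pms S. \<phi> x)
    = (\<Sum>z\<in>(SIGMA a:S - {p}. pms (S - {p, a})). \<phi> ((\<lambda>(a, m). insert {p, a} m) z))"
    using sum.reindex_bij_betw[OF bij_betw_insert_edge[OF assms(2)], of \<phi>] by simp
  also have "\<dots> = (\<Sum>a\<in>S - {p}. \<Sum>m\<in>pms (S - {p, a}). \<phi> (insert {p, a} m))"
    using assms by (subst sum.Sigma) (auto simp: finite_pms case_prod_unfold)
  finally show ?thesis .
qed

section \<open>The number of perfect matchings\<close>

lemma card_pms:
  assumes "finite S" "card S = 2 * k"
  shows "card (pms S) = double_fact (2 * k - 1)"
  using assms
proof (induction k arbitrary: S)
  case 0
  then show ?case by (simp add: pms_empty)
next
  case (Suc k)
  then obtain p where p: "p \<in> S" by fastforce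
  have "card (pms (S - {p, a})) = double_fact (2 * k - 1)" if "a \<in> S - {p}" for a
    using Suc p that by (intro Suc.IH) (auto simp: card_Diff_subset)
  then have "card (pms S) = (\<Sum>a\<in>S - {p}. double_fact (2 * k - 1))"
    using sum_pms_partner[OF Suc.prems(1) p, of "\<lambda>_. 1 :: nat"] by simp
  also have "\<dots> = (2 * k + 1) * double_fact (2 * k - 1)"
    using Suc.prems p by simp
  \<comment> \<open>The case \<open>k = 0\<close> is separate because \<open>2 * k - 1\<close> is
    truncated there; \<open>double_fact 0 = 1\<close> then stands in for the convention (-1)!! =
    1.\<close>
  also have "\<dots> = double_fact (2 * Suc k - 1)"
    by (cases k) auto
  finally show ?case .
qed

lemma double_fact_pos: "double_fact k > 0"
  by (induction k rule: double_fact.induct) auto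

section \<open>Relabelling and swapping vertices\<close>

lemma relabel_insert: "relabel \<sigma> (insert e m) = insert (\<sigma> ` e) (relabel \<sigma> m)"
  by (simp add: relabel_def)

lemma relabel_fixed:
  assumes "\<And>v. v \<in> S \<Longrightarrow> \<sigma> v = v" "m \<in> pms S"
  shows "relabel \<sigma> m = m"
proof -
  have "\<sigma> ` e = e" if "e \<in> m" for e
    using assms(1) pms_edge(1)[OF assms(2) that] by (metis image_cong image_ident subsetD)
  then show ?thesis by (simp add: relabel_def)
qed

lemma relabel_pms:
  assumes "inj \<sigma>" "m \<in> pms S"
  shows "relabel \<sigma> m \<in> pms (\<sigma> ` S)"
proof (rule pmsI)
  fix e assume "e \<in> relabel \<sigma> m"
  then show "e \<subseteq> \<sigma> ` S \<and> card e = 2"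
    using pms_edge[OF assms(2)] assms(1)
    by (auto simp: relabel_def card_image inj_on_subset)
next
  fix v assume "v \<in> \<sigma> ` S"
  then show "\<exists>e\<in>relabel \<sigma> m. v \<in> e" using pms_covers[OF assms(2)] by (auto simp: relabel_def)
next
  fix e e' v assume "e \<in> relabel \<sigma> m" "e' \<in> relabel \<sigma> m" "v \<in> e" "v \<in> e'"
  then obtain d d' where d: "d \<in> m" "d' \<in> m" "e = \<sigma> ` d" "e' = \<sigma> ` d'"
    "v \<in> \<sigma> ` d" "v \<in> \<sigma> ` d'" by (auto simp: relabel_def)
  then obtain z where "z \<in> d" "z \<in> d'" using assms(1) by (auto dest: injD)
  then show "e = e'" using pms_unique[OF assms(2) d(1,2)] d(3,4) by blast
qed

abbreviation swap :: "'a \<Rightarrow> 'a \<Rightarrow> 'a set set \<Rightarrow> 'a set set" where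
  "swap a w \<equiv> relabel (transpose a w)"

lemma swap_commute: "swap a w = swap w a"
  by (simp add: transpose_commute)

lemma swap_swap [simp]: "swap a w (swap a w m) = m"
  by (simp add: relabel_def image_image)

text \<open>The transposition fixes all vertices covered by \<open>m\<close>, so only the edge
  \<open>{b, c}\<close> changes: \<open>c\<close> is rematched to \<open>a\<close>, and
  \<open>b\<close> becomes the uncovered vertex in place of \<open>a\<close>.\<close>

lemma swap_insert:
  assumes "m \<in> pms (T - {a, b, c})" "a \<noteq> b" "c \<noteq> a" "c \<noteq> b"
  shows "swap a b (insert {b, c} m) = insert {a, c} m"
  using assms relabel_fixed[OF _ assms(1), of "transpose a b"]
  by (auto simp: relabel_insert transpose_apply_other)

lemma bij_betw_swap:
  assumes "a \<in> T" "w \<in> T"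
  shows "bij_betw (swap a w) (pms (T - {a})) (pms (T - {w}))"
proof (rule bij_betwI[where g = "swap a w"])
  have *: "swap a w m \<in> pms (T - {w})" if "m \<in> pms (T - {a})" "a \<in> T" "w \<in> T" for a w m
  proof -
    have "transpose a w ` (T - {a}) = T - {w}"
      using that(2,3) by (auto simp: image_iff transpose_def split: if_splits)
    then show ?thesis using relabel_pms[OF inj_transpose that(1), of a w] by simp
  qed
  show "swap a w \<in> pms (T - {a}) \<rightarrow> pms (T - {w})" using * assms by blast
  show "swap a w \<in> pms (T - {w}) \<rightarrow> pms (T - {a})" using *[of _ w a] assms by (simp add: swap_commute)
qed simp_all

lemma sum_pms_swap:
  assumes "a \<in> T" "w \<in> T"
  shows "(\<Sum>m\<in>pms (T - {a}). \<phi> (swap a w m)) = (\<Sum>m\<in>pms (T - {w}). \<phi> m)"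
  using sum.reindex_bij_betw[OF bij_betw_swap[OF assms]] .

section \<open>Connected unions\<close>

text \<open>Reachability ignores multiplicities, so the set union takes the place of the multiset
  union.\<close>

definition joined :: "'a set \<Rightarrow> 'a set set \<Rightarrow> 'a set set \<Rightarrow> bool" where
  "joined S x y \<longleftrightarrow> (\<forall>u\<in>S. \<forall>v\<in>S. (u, v) \<in> {(a, b). {a, b} \<in> x \<union> y}\<^sup>*)"

lemma multigraph_connected_iff_joined:
  assumes "finite S" "S \<noteq> {}" "x \<in> pms S" "y \<in> pms S"
  shows "multigraph_connected S (matching_union x y) \<longleftrightarrow> joined S x y"
  using assms finite_pm[OF assms(1)]
  by (simp add: multigraph_connected_def matching_union_def joined_def)

lemma joined_commute: "joined S x y = joined S y x"
  by (simp add: joined_def Un_commute)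

text \<open>No other edge of either matching meets \<open>p\<close> or \<open>a\<close>, so a walk
  from \<open>p\<close> never leaves \<open>{p, a}\<close>, while \<open>S\<close> has a third
  vertex.\<close>

lemma joined_common_edge:
  assumes "card S > 2" "p \<in> S" "a \<in> S" "m \<in> pms (S - {p, a})" "m2 \<in> pms (S - {p, a})"
  shows "\<not> joined S (insert {p, a} m) (insert {p, a} m2)"
proof
  assume *: "joined S (insert {p, a} m) (insert {p, a} m2)"
  have "card {p, a} \<le> 2" by (simp add: card_insert_if)
  then have "\<not> S \<subseteq> {p, a}" using assms(1) card_mono[of "{p, a}" S] by auto
  then obtain v where v: "v \<in> S" "v \<notin> {p, a}" by blast
  let ?R = "{(u, v). {u, v} \<in> insert {p, a} m \<union> insert {p, a} m2}"
  have "(p, v) \<in> ?R\<^sup>*" using * v assms by (auto simp: joined_def)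
  then have "v \<in> {p, a}"
  proof induction
    case (step y z)
    then show ?case using pms_edge(1)[OF assms(4)] pms_edge(1)[OF assms(5)]
      by (auto simp: doubleton_eq_iff)
  qed simp
  then show False using v by simp
qed

text \<open>Contract the path \<open>w - p - a\<close> of the union to the single vertex \<open>w\<close>.\<close>

lemma joined_contract:
  assumes "p \<in> S" "a \<in> S" "w \<in> S" "p \<noteq> a" "p \<noteq> w" "a \<noteq> w"
    and m: "m \<in> pms (S - {p, a})" and m2: "m2 \<in> pms (S - {p, w})"
  shows "joined S (insert {p, a} m) (insert {p, w} m2) \<longleftrightarrow>
    joined (S - {p, a}) m (swap a w m2)"
proof -
  let ?R = "{(u, v). {u, v} \<in> insert {p, a} m \<union> insert {p, w} m2}"
  let ?R' = "{(u, v). {u, v} \<in> m \<union> swap a w m2}"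
  \<comment> \<open>\<open>c\<close> is the contraction: \<open>p\<close> and \<open>a\<close> are
    both sent to \<open>w\<close>, the one vertex of the path that lies in
    \<open>S - {p, a}\<close>.\<close>
  define c where "c u = (if u = p \<or> u = a then w else u)" for u
  \<comment> \<open>Edges of \<open>m2\<close> avoid \<open>p\<close> and \<open>w\<close>, so on
    them the transposition can only send \<open>a\<close> to \<open>w\<close>, which is what
    \<open>c\<close> does.\<close>
  have swap_edge: "transpose a w ` e = c ` e" if "e \<in> m2" for e
    using pms_edge(1)[OF m2 that] unfolding c_def transpose_def by (intro image_cong) auto
  have img: "(c u, c v) \<in> ?R'\<^sup>*" if "(u, v) \<in> ?R" for u v
  proof -
    consider "{u, v} = {p, a}" | "{u, v} = {p, w}" | "{u, v} \<in> m" | "{u, v} \<in> m2"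
      using \<open>(u, v) \<in> ?R\<close> by auto
    then show ?thesis
    proof cases
      case 3
      then have "c u = u" "c v = v" using pms_edge(1)[OF m] by (auto simp: c_def)
      then show ?thesis using 3 by auto
    next
      case 4
      then have "{c u, c v} \<in> swap a w m2" using imageI[OF 4, of "(`) (transpose a w)"] swap_edge[OF 4] by (simp add: relabel_def)
      then show ?thesis by auto
    qed (auto simp: c_def doubleton_eq_iff)
  qed
  \<comment> \<open>An edge of the contracted union is an edge of the original one up to exchanging
    \<open>a\<close> and \<open>w\<close>, and these two are connected through
    \<open>p\<close>.\<close>
  have lift: "(u, v) \<in> ?R\<^sup>*" if uv: "(u, v) \<in> ?R'" for u v
  proof -
    have wa: "(w, a) \<in> ?R\<^sup>*" "(a, w) \<in> ?R\<^sup>*"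
      by (rule rtrancl_trans[of _ p]; auto simp: insert_commute)+
    consider "{u, v} \<in> m" | e where "e \<in> m2" "{u, v} = transpose a w ` e"
      using uv by (auto simp: relabel_def)
    then show ?thesis
    proof cases
      case 2
      then have "transpose a w ` {u, v} = e" by (simp only: image_image) simp
      then have e: "{transpose a w u, transpose a w v} \<in> m2" using 2(1) by simp
      have step: "(z, transpose a w z) \<in> ?R\<^sup>*" "(transpose a w z, z) \<in> ?R\<^sup>*" for z
        using wa by (cases "z = a"; cases "z = w"; simp)+
      have "(transpose a w u, transpose a w v) \<in> ?R\<^sup>*" using e by auto
      then show ?thesis using step by (meson rtrancl_trans)
    qed auto
  qed
  show ?thesis
  proof
    assume *: "joined S (insert {p, a} m) (insert {p, w} m2)"
    have "(u, v) \<in> ?R'\<^sup>*" if "u \<in> S - {p, a}" "v \<in> S - {p, a}" for u v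
    proof -
      have "(u, v) \<in> ?R\<^sup>*" using * that by (auto simp: joined_def)
      then have "(c u, c v) \<in> ?R'\<^sup>*"
        by induction (use img in \<open>auto intro: rtrancl_trans\<close>)
      then show ?thesis using that by (auto simp: c_def)
    qed
    then show "joined (S - {p, a}) m (swap a w m2)" by (simp add: joined_def)
  next
    assume *: "joined (S - {p, a}) m (swap a w m2)"
    have *: "(u, v) \<in> ?R\<^sup>*" if "u \<in> S - {p, a}" "v \<in> S - {p, a}" for u v
    proof -
      have "(u, v) \<in> ?R'\<^sup>*" using * that by (auto simp: joined_def)
      then show ?thesis by induction (use lift in \<open>auto intro: rtrancl_trans\<close>)
    qed
    have w: "(u, c u) \<in> ?R\<^sup>*" "(c u, u) \<in> ?R\<^sup>*" for u
    proof -
      have pw: "(p, w) \<in> ?R\<^sup>*" "(w, p) \<in> ?R\<^sup>*" and "(a, p) \<in> ?R\<^sup>*" "(p, a) \<in> ?R\<^sup>*"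
        by (auto simp: insert_commute)
      then have "(a, w) \<in> ?R\<^sup>*" "(w, a) \<in> ?R\<^sup>*" by (meson rtrancl_trans)+
      with pw show "(u, c u) \<in> ?R\<^sup>*" "(c u, u) \<in> ?R\<^sup>*"
        by (simp_all add: c_def)
    qed
    have "(u, v) \<in> ?R\<^sup>*" if "u \<in> S" "v \<in> S" for u v
    proof -
      have "c u \<in> S - {p, a}" "c v \<in> S - {p, a}" using that assms by (auto simp: c_def)
      then show ?thesis using * w by (meson rtrancl_trans)
    qed
    then show "joined S (insert {p, a} m) (insert {p, w} m2)" by (simp add: joined_def)
  qed
qed

section \<open>Moving the uncovered vertex of a near-perfect matching\<close>

text \<open>A matching that misses exactly one vertex is encoded as a pair of that vertex
  \<open>a\<close> and a perfect matching \<open>m\<close> of the rest. Applied to products, the sum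
  is the inner product of functions of such pairs.\<close>

definition near_sum :: "'a set \<Rightarrow> ('a \<Rightarrow> 'a set set \<Rightarrow> real) \<Rightarrow> real" where
  "near_sum T \<phi> = (\<Sum>a\<in>T. \<Sum>m\<in>pms (T - {a}). \<phi> a m)"

text \<open>The adjacency operator that joins \<open>(a, m)\<close> to
  \<open>(w, swap a w m)\<close>, where the partner of \<open>w\<close> in \<open>m\<close> has been
  rematched to \<open>a\<close>.\<close>

definition move :: "'a set \<Rightarrow> ('a \<Rightarrow> 'a set set \<Rightarrow> real) \<Rightarrow> 'a \<Rightarrow> 'a set set \<Rightarrow> real" where
  "move T f a m = (\<Sum>w\<in>T - {a}. f w (swap a w m))"

text \<open>A sum over near-perfect matchings with a marked oriented edge \<open>(b, c)\<close>;
  \<open>m\<close> is what remains besides the uncovered vertex \<open>a\<close> and the marked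
  edge.\<close>

definition triple_sum :: "'a set \<Rightarrow> ('a \<Rightarrow> 'a \<Rightarrow> 'a \<Rightarrow> 'a set set \<Rightarrow> real) \<Rightarrow> real" where
  "triple_sum T \<phi> = (\<Sum>a\<in>T. \<Sum>b\<in>T - {a}. \<Sum>c\<in>T - {a, b}. \<Sum>m\<in>pms (T - {a, b, c}). \<phi> a b c m)"

section \<open>Linearity and reordering of the sums\<close>

lemma near_sum_add: "near_sum T (\<lambda>a m. \<phi> a m + \<psi> a m) = near_sum T \<phi> + near_sum T \<psi>"
  by (simp add: near_sum_def sum.distrib)

lemma near_sum_diff: "near_sum T (\<lambda>a m. \<phi> a m - \<psi> a m) = near_sum T \<phi> - near_sum T \<psi>"
  by (simp add: near_sum_def sum_subtractf)

lemma near_sum_cmult: "near_sum T (\<lambda>a m. r * \<phi> a m) = r * near_sum T \<phi>"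
  by (simp add: near_sum_def sum_distrib_left)

lemma near_sum_cong:
  "(\<And>a m. a \<in> T \<Longrightarrow> m \<in> pms (T - {a}) \<Longrightarrow> \<phi> a m = \<psi> a m) \<Longrightarrow> near_sum T \<phi> = near_sum T \<psi>"
  by (simp add: near_sum_def)

lemma near_sum_nonneg: "(\<And>a m. \<phi> a m \<ge> 0) \<Longrightarrow> near_sum T \<phi> \<ge> 0"
  by (simp add: near_sum_def sum_nonneg)

lemma triple_sum_add:
  "triple_sum T (\<lambda>a b c m. \<phi> a b c m + \<psi> a b c m) = triple_sum T \<phi> + triple_sum T \<psi>"
  by (simp add: triple_sum_def sum.distrib)

lemma triple_sum_diff:
  "triple_sum T (\<lambda>a b c m. \<phi> a b c m - \<psi> a b c m) = triple_sum T \<phi> - triple_sum T \<psi>"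
  by (simp add: triple_sum_def sum_subtractf)

lemma triple_sum_cmult: "triple_sum T (\<lambda>a b c m. r * \<phi> a b c m) = r * triple_sum T \<phi>"
  by (simp add: triple_sum_def sum_distrib_left)

lemma triple_sum_cong:
  assumes "\<And>a b c m. \<lbrakk>a \<in> T; b \<in> T; c \<in> T; a \<noteq> b; a \<noteq> c; b \<noteq> c; m \<in> pms (T - {a, b, c})\<rbrakk>
    \<Longrightarrow> \<phi> a b c m = \<psi> a b c m"
  shows "triple_sum T \<phi> = triple_sum T \<psi>"
  unfolding triple_sum_def by (intro sum.cong refl) (use assms in auto)

lemma triple_sum_nonneg: "(\<And>a b c m. \<phi> a b c m \<ge> 0) \<Longrightarrow> triple_sum T \<phi> \<ge> 0"
  by (simp add: triple_sum_def sum_nonneg)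

lemma triple_sum_zero:
  assumes "\<And>a b c. \<lbrakk>a \<in> T; b \<in> T; c \<in> T; a \<noteq> b; a \<noteq> c; b \<noteq> c\<rbrakk>
    \<Longrightarrow> (\<Sum>m\<in>pms (T - {a, b, c}). \<phi> a b c m) = 0"
  shows "triple_sum T \<phi> = 0"
  unfolding triple_sum_def
  by (rule sum.neutral, rule ballI, rule sum.neutral, rule ballI, rule sum.neutral, rule ballI)
    (use assms in auto)

lemma sum_pairs_swap:
  fixes g :: "'a \<Rightarrow> 'a \<Rightarrow> real"
  assumes "finite T"
  shows "(\<Sum>a\<in>T. \<Sum>b\<in>T - {a}. g a b) = (\<Sum>a\<in>T. \<Sum>b\<in>T - {a}. g b a)"
proof -
  have *: "(\<Sum>b\<in>T - {a}. h b) = (\<Sum>b\<in>T. if a \<noteq> b then h b else 0)" for a and h :: "'a \<Rightarrow> real"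
    using assms by (intro sum.mono_neutral_cong_left) auto
  show ?thesis
    unfolding * by (subst sum.swap) (intro sum.cong refl, auto)
qed

lemma triple_sum_swap12:
  assumes "finite T"
  shows "triple_sum T \<phi> = triple_sum T (\<lambda>a b c m. \<phi> b a c m)"
  unfolding triple_sum_def
  by (subst sum_pairs_swap[OF assms]) (simp add: insert_commute)

lemma triple_sum_swap23:
  assumes "finite T"
  shows "triple_sum T \<phi> = triple_sum T (\<lambda>a b c m. \<phi> a c b m)"
  unfolding triple_sum_def
proof (rule sum.cong[OF refl])
  fix a assume "a \<in> T"
  have "T - {a, b} = T - {a} - {b}" for b by blast
  moreover have "{a, c, b} = {a, b, c}" for b c by blast
  ultimately show "(\<Sum>b\<in>T - {a}. \<Sum>c\<in>T - {a, b}. \<Sum>m\<in>pms (T - {a, b, c}). \<phi> a b c m)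
    = (\<Sum>b\<in>T - {a}. \<Sum>c\<in>T - {a, b}. \<Sum>m\<in>pms (T - {a, b, c}). \<phi> a c b m)"
    using sum_pairs_swap[of "T - {a}" "\<lambda>b c. \<Sum>m\<in>pms (T - {a, b, c}). \<phi> a b c m"] assms by simp
qed

text \<open>With the marked edge chosen first, the inner sum runs over near-perfect matchings of
  \<open>T - {b, c}\<close>, which is where induction applies.\<close>

lemma triple_sum_link:
  assumes "finite T"
  shows "triple_sum T \<phi> = (\<Sum>b\<in>T. \<Sum>c\<in>T - {b}. near_sum (T - {b, c}) (\<lambda>a m. \<phi> a b c m))"
proof -
  have "triple_sum T \<phi> = triple_sum T (\<lambda>a b c m. \<phi> b a c m)"
    by (rule triple_sum_swap12[OF assms])
  also have "\<dots> = triple_sum T (\<lambda>a b c m. \<phi> c a b m)"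
    by (rule triple_sum_swap23[OF assms])
  also have "\<dots> = (\<Sum>b\<in>T. \<Sum>c\<in>T - {b}. near_sum (T - {b, c}) (\<lambda>a m. \<phi> a b c m))"
  proof -
    have "T - {b, c} - {a} = T - {b, c, a}" for a b c by blast
    then show ?thesis by (simp add: triple_sum_def near_sum_def)
  qed
  finally show ?thesis .
qed

text \<open>Double counting: a perfect matching of \<open>T - {a}\<close> has \<open>k\<close>
  edges, each marked in two orientations. For each of the \<open>2 * k\<close> choices of
  \<open>b\<close>, its partner \<open>c\<close> and the rest enumerate all matchings of
  \<open>T - {a}\<close>.\<close>

lemma near_sum_to_triple:
  assumes "finite T" "card T = 2 * k + 1"
  shows "2 * real k * near_sum T \<phi> = triple_sum T (\<lambda>a b c m. \<phi> a (insert {b, c} m))"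
proof -
  have "2 * real k * (\<Sum>m\<in>pms (T - {a}). \<phi> a m)
    = (\<Sum>b\<in>T - {a}. \<Sum>c\<in>T - {a, b}. \<Sum>m\<in>pms (T - {a, b, c}). \<phi> a (insert {b, c} m))"
    if "a \<in> T" for a
  proof -
    have "(\<Sum>m\<in>pms (T - {a}). \<phi> a m)
      = (\<Sum>c\<in>T - {a, b}. \<Sum>m\<in>pms (T - {a, b, c}). \<phi> a (insert {b, c} m))" if "b \<in> T - {a}" for b
    proof -
      have "T - {a} - {b} = T - {a, b}" "T - {a} - {b, c} = T - {a, b, c}" for c by blast+
      then show ?thesis using sum_pms_partner[of "T - {a}" b "\<phi> a"] that assms(1) by simp
    qed
    then have "(\<Sum>b\<in>T - {a}. \<Sum>c\<in>T - {a, b}. \<Sum>m\<in>pms (T - {a, b, c}). \<phi> a (insert {b, c} m))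
      = (\<Sum>b\<in>T - {a}. \<Sum>m\<in>pms (T - {a}). \<phi> a m)" by simp
    then show ?thesis using assms that by simp
  qed
  then show ?thesis by (simp add: near_sum_def triple_sum_def sum_distrib_left)
qed

section \<open>The quadratic form of the move operator\<close>

lemma near_sum_move:
  assumes "finite T"
  shows "near_sum T (\<lambda>a m. x a m * move T y a m)
    = (\<Sum>a\<in>T. \<Sum>w\<in>T - {a}. \<Sum>m\<in>pms (T - {a}). x a m * y w (swap a w m))"
  unfolding near_sum_def move_def sum_distrib_left
  by (rule sum.cong[OF refl]) (rule sum.swap)

text \<open>Since \<open>swap a w\<close> is an involution between the matchings missing
  \<open>a\<close> and those missing \<open>w\<close>, adjacency is symmetric.\<close>

lemma move_selfadjoint:
  assumes "finite T"
  shows "near_sum T (\<lambda>a m. x a m * move T y a m) = near_sum T (\<lambda>a m. y a m * move T x a m)"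
proof -
  have "near_sum T (\<lambda>a m. x a m * move T y a m)
    = (\<Sum>a\<in>T. \<Sum>w\<in>T - {a}. \<Sum>m\<in>pms (T - {w}). x a (swap a w m) * y w m)"
    unfolding near_sum_move[OF assms]
  proof (rule sum.cong[OF refl], rule sum.cong[OF refl])
    fix a w assume "a \<in> T" "w \<in> T - {a}"
    then show "(\<Sum>m\<in>pms (T - {a}). x a m * y w (swap a w m))
      = (\<Sum>m\<in>pms (T - {w}). x a (swap a w m) * y w m)"
      using sum_pms_swap[of a T w "\<lambda>m. x a (swap a w m) * y w m"] by simp
  qed
  also have "\<dots> = near_sum T (\<lambda>a m. y a m * move T x a m)"
    unfolding near_sum_move[OF assms]
    by (subst sum_pairs_swap[OF assms]) (simp add: swap_commute mult.commute)
  finally show ?thesis .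
qed

text \<open>Here the marked edge \<open>{b, c}\<close> is the one that the move to \<open>b\<close>
  destroys; it is replaced by \<open>{a, c}\<close>.\<close>

lemma near_sum_move_triple:
  assumes "finite T"
  shows "near_sum T (\<lambda>a m. f a m * move T f a m)
    = triple_sum T (\<lambda>a b c m. f a (insert {b, c} m) * f b (insert {a, c} m))"
  unfolding near_sum_move[OF assms] triple_sum_def
proof (intro sum.cong refl)
  fix a b assume ab: "a \<in> T" "b \<in> T - {a}"
  have *: "T - {a} - {b} = T - {a, b}" "T - {a} - {b, c} = T - {a, b, c}" for c by blast+
  have "(\<Sum>m\<in>pms (T - {a}). f a m * f b (swap a b m))
    = (\<Sum>c\<in>T - {a, b}. \<Sum>m\<in>pms (T - {a, b, c}).
        f a (insert {b, c} m) * f b (swap a b (insert {b, c} m)))"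
    using sum_pms_partner[of "T - {a}" b] ab assms by (simp add: *)
  also have "\<dots> = (\<Sum>c\<in>T - {a, b}. \<Sum>m\<in>pms (T - {a, b, c}).
      f a (insert {b, c} m) * f b (insert {a, c} m))"
  proof (intro sum.cong refl)
    fix c m assume "c \<in> T - {a, b}" "m \<in> pms (T - {a, b, c})"
    then have "swap a b (insert {b, c} m) = insert {a, c} m"
      using ab by (intro swap_insert) auto
    then show "f a (insert {b, c} m) * f b (swap a b (insert {b, c} m))
      = f a (insert {b, c} m) * f b (insert {a, c} m)" by simp
  qed
  finally show "(\<Sum>m\<in>pms (T - {a}). f a m * f b (swap a b m)) = \<dots>" .
qed

text \<open>For each \<open>w\<close>, swapping reindexes the sum to all matchings missing
  \<open>w\<close>, where the total is zero. The functions orthogonal to all functions of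
  \<open>a\<close> alone thus form an invariant subspace.\<close>

lemma sum_move_zero:
  assumes "finite T" "a \<in> T" "\<And>a. a \<in> T \<Longrightarrow> (\<Sum>m\<in>pms (T - {a}). f a m) = 0"
  shows "(\<Sum>m\<in>pms (T - {a}). move T f a m) = 0"
proof -
  have "(\<Sum>m\<in>pms (T - {a}). move T f a m) = (\<Sum>w\<in>T - {a}. \<Sum>m\<in>pms (T - {a}). f w (swap a w m))"
    unfolding move_def by (rule sum.swap)
  also have "\<dots> = 0"
    using assms by (intro sum.neutral) (auto simp: sum_pms_swap)
  finally show ?thesis .
qed

text \<open>Both cross terms vanish: \<open>f\<close> and \<open>move T f\<close> are orthogonal to
  functions of the uncovered vertex, and \<open>move\<close> sends such a function to another
  one.\<close>

lemma near_sum_move_split: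
  assumes "finite T" "\<And>a. a \<in> T \<Longrightarrow> (\<Sum>m\<in>pms (T - {a}). f a m) = 0"
  shows "near_sum T (\<lambda>a m. (f a m + u a) * move T (\<lambda>w m. f w m + u w) a m)
    = near_sum T (\<lambda>a m. f a m * move T f a m) + near_sum T (\<lambda>a m. u a * (\<Sum>w\<in>T - {a}. u w))"
proof -
  have "near_sum T (\<lambda>a m. (f a m + u a) * move T (\<lambda>w m. f w m + u w) a m)
    = near_sum T (\<lambda>a m. f a m * move T f a m + u a * (\<Sum>w\<in>T - {a}. u w)
        + (f a m * (\<Sum>w\<in>T - {a}. u w) + u a * move T f a m))"
    by (simp add: move_def sum.distrib algebra_simps)
  also have "\<dots> = near_sum T (\<lambda>a m. f a m * move T f a m)
      + near_sum T (\<lambda>a m. u a * (\<Sum>w\<in>T - {a}. u w))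
      + near_sum T (\<lambda>a m. f a m * (\<Sum>w\<in>T - {a}. u w) + u a * move T f a m)"
    by (simp only: near_sum_add)
  also have "near_sum T (\<lambda>a m. f a m * (\<Sum>w\<in>T - {a}. u w) + u a * move T f a m) = 0"
    unfolding near_sum_def
  proof (rule sum.neutral, rule ballI)
    fix a assume "a \<in> T"
    then show "(\<Sum>m\<in>pms (T - {a}). f a m * (\<Sum>w\<in>T - {a}. u w) + u a * move T f a m) = 0"
      using assms sum_move_zero[OF assms(1) _ assms(2), of a]
      by (simp add: sum.distrib flip: sum_distrib_left sum_distrib_right)
  qed
  finally show ?thesis by simp
qed

text \<open>The matchings obtained from one another by moving the uncovered vertex along a fixed edge
  form triangles, so the graph behind \<^const>\<open>move\<close> is an edge-disjoint union of triangles with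
  \<open>k\<close> of them at each vertex.\<close>

lemma move_lower:
  assumes "finite T" "card T = 2 * k + 1"
  shows "- real k * near_sum T (\<lambda>a m. (f a m)\<^sup>2) \<le> near_sum T (\<lambda>a m. f a m * move T f a m)"
proof -
  define F where "F a b c m = f a (insert {b, c} m)" for a b c m
  have sym: "F a c b m = F a b c m" for a b c m by (simp add: F_def insert_commute)
  define N where "N = triple_sum T (\<lambda>a b c m. (F a b c m)\<^sup>2)"
  define Q where "Q = triple_sum T (\<lambda>a b c m. F a b c m * F b a c m)"
  have N: "2 * real k * near_sum T (\<lambda>a m. (f a m)\<^sup>2) = N"
    unfolding N_def F_def near_sum_to_triple[OF assms] ..
  have Q: "near_sum T (\<lambda>a m. f a m * move T f a m) = Q"
    unfolding Q_def F_def near_sum_move_triple[OF assms(1)] ..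
  have N2: "triple_sum T (\<lambda>a b c m. (F b a c m)\<^sup>2) = N"
    unfolding N_def by (rule triple_sum_swap12[OF assms(1), symmetric])
  have N3: "triple_sum T (\<lambda>a b c m. (F c a b m)\<^sup>2) = N"
    using triple_sum_swap23[OF assms(1), of "\<lambda>a b c m. (F b a c m)\<^sup>2"] N2 by simp
  have Q2: "triple_sum T (\<lambda>a b c m. F a b c m * F c a b m) = Q"
    unfolding Q_def by (subst triple_sum_swap23[OF assms(1)]) (simp add: sym)
  have Q3: "triple_sum T (\<lambda>a b c m. F b a c m * F c a b m) = Q"
    using triple_sum_swap12[OF assms(1), of "\<lambda>a b c m. F a b c m * F c a b m"] Q2
    by (simp add: sym)
  \<comment> \<open>The three values belong to one triangle: \<open>m\<close> together with one of
    the three edges on \<open>{a, b, c}\<close>. By relabelling the triple, every square contributes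
    \<open>N\<close> and every product \<open>Q\<close>.\<close>
  have "0 \<le> triple_sum T (\<lambda>a b c m. (F a b c m + F b a c m + F c a b m)\<^sup>2)"
    by (rule triple_sum_nonneg) simp
  also have "\<dots> = triple_sum T (\<lambda>a b c m. (F a b c m)\<^sup>2 + (F b a c m)\<^sup>2 + (F c a b m)\<^sup>2
      + (2 * (F a b c m * F b a c m) + 2 * (F a b c m * F c a b m) + 2 * (F b a c m * F c a b m)))"
    by (intro triple_sum_cong) (simp add: power2_eq_square algebra_simps)
  also have "\<dots> = 3 * N + 6 * Q"
    by (simp only: triple_sum_add triple_sum_cmult N2 N3 Q2 Q3 flip: N_def Q_def)
  finally show ?thesis using N Q by linarith
qed

section \<open>A quadratic form in functions of three vertices\<close>

definition cube_sum :: "'a set \<Rightarrow> ('a \<Rightarrow> 'a \<Rightarrow> 'a \<Rightarrow> real) \<Rightarrow> real" where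
  "cube_sum T \<phi> = (\<Sum>a\<in>T. \<Sum>b\<in>T. \<Sum>c\<in>T. \<phi> a b c)"

lemma cube_sum_add: "cube_sum T (\<lambda>a b c. \<phi> a b c + \<psi> a b c) = cube_sum T \<phi> + cube_sum T \<psi>"
  by (simp add: cube_sum_def sum.distrib)

lemma cube_sum_diff: "cube_sum T (\<lambda>a b c. \<phi> a b c - \<psi> a b c) = cube_sum T \<phi> - cube_sum T \<psi>"
  by (simp add: cube_sum_def sum_subtractf)

lemma cube_sum_cmult: "cube_sum T (\<lambda>a b c. r * \<phi> a b c) = r * cube_sum T \<phi>"
  by (simp add: cube_sum_def sum_distrib_left)

lemma cube_sum_cong:
  "(\<And>a b c. a \<in> T \<Longrightarrow> b \<in> T \<Longrightarrow> c \<in> T \<Longrightarrow> \<phi> a b c = \<psi> a b c) \<Longrightarrow> cube_sum T \<phi> = cube_sum T \<psi>"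
  by (simp add: cube_sum_def)

lemma cube_sum_nonneg: "(\<And>a b c. \<phi> a b c \<ge> 0) \<Longrightarrow> cube_sum T \<phi> \<ge> 0"
  by (simp add: cube_sum_def sum_nonneg)

lemma cube_sum_swap12: "cube_sum T \<phi> = cube_sum T (\<lambda>a b c. \<phi> b a c)"
  unfolding cube_sum_def by (rule sum.swap)

lemma cube_sum_swap23: "cube_sum T \<phi> = cube_sum T (\<lambda>a b c. \<phi> a c b)"
  unfolding cube_sum_def by (rule sum.cong[OF refl], rule sum.swap)

lemma cube_sum_last: "cube_sum T (\<lambda>a b c. x a b * \<phi> a b c) = (\<Sum>a\<in>T. \<Sum>b\<in>T. x a b * (\<Sum>c\<in>T. \<phi> a b c))"
  by (simp add: cube_sum_def sum_distrib_left)

lemma cube_sum_first: "cube_sum T (\<lambda>a b c. x b c * \<phi> a b c) = (\<Sum>b\<in>T. \<Sum>c\<in>T. x b c * (\<Sum>a\<in>T. \<phi> a b c))"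
proof -
  have "cube_sum T (\<lambda>a b c. x b c * \<phi> a b c) = cube_sum T (\<lambda>b a c. x b c * \<phi> a b c)"
    by (rule cube_sum_swap12)
  also have "\<dots> = cube_sum T (\<lambda>b c a. x b c * \<phi> a b c)" by (rule cube_sum_swap23)
  finally show ?thesis by (simp add: cube_sum_last)
qed

text \<open>The operator in the form is \<open>t + L - 2 * G\<close>, so the claim says that
  \<open>t + L\<close> has form at most \<open>v - 1\<close> times the squared norm of
  \<open>G\<close>. Two completed squares prove it, the first one needing the second to control its
  remainder.\<close>

lemma cube_form_bound:
  fixes G :: "'a \<Rightarrow> 'a \<Rightarrow> 'a \<Rightarrow> real"
  assumes fin: "finite T" and card: "card T \<ge> 5"
    and zero: "\<And>a b c. a = b \<or> a = c \<or> b = c \<Longrightarrow> G a b c = 0"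
    and sym: "\<And>a b c. G a b c = G a c b"
    and sum0: "\<And>a p. a \<in> T \<Longrightarrow> p \<in> T \<Longrightarrow> (\<Sum>q\<in>T. G a p q) = 0"
  shows "cube_sum T (\<lambda>a b c. G a b c * (G b a c + G c b a + (\<Sum>w\<in>T. G w b c) - G a b c))
    \<le> (real (card T) - 3) * cube_sum T (\<lambda>a b c. (G a b c)\<^sup>2)"
proof -
  define v where "v = real (card T)"
  have v: "v > 4" using card by (simp add: v_def)
  define K where "K b c = (\<Sum>w\<in>T. G w b c)" for b c
  \<comment> \<open>\<open>t\<close> is three times the symmetrisation of \<open>G\<close>.
    \<open>L\<close> is the sum \<open>K\<close> over the first vertex, cut off at repeated
    vertices, where \<open>G\<close> and \<open>t\<close> vanish too.\<close>
  define t where "t a b c = G a b c + G b a c + G c a b" for a b c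
  define L where "L a b c = (if a = b \<or> a = c then 0 else K b c)" for a b c
  define g where "g = cube_sum T (\<lambda>a b c. G a b c * G a b c)"
  define P where "P = cube_sum T (\<lambda>a b c. t a b c * t a b c)"
  define \<kappa> where "\<kappa> = (\<Sum>b\<in>T. \<Sum>c\<in>T. K b c * K b c)"
  have Ksym: "K b c = K c b" for b c unfolding K_def by (simp add: sym[of _ b c])
  have K0: "K b b = 0" for b by (simp add: K_def zero)
  have Ksum: "(\<Sum>c\<in>T. K b c) = 0" if "b \<in> T" for b
    unfolding K_def by (subst sum.swap) (simp add: sum0 that)
  have t12: "t b a c = t a b c" and t23: "t a c b = t a b c" for a b c
    using sym[of a b c] sym[of b c a] sym[of c b a] sym[of b a c] sym[of c a b]
    by (simp_all add: t_def)
  have tsum: "(\<Sum>a\<in>T. t a b c) = K b c" if "b \<in> T" "c \<in> T" for b c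
  proof -
    have "(\<Sum>a\<in>T. t a b c) = K b c + (\<Sum>a\<in>T. G b c a) + (\<Sum>a\<in>T. G c b a)"
      unfolding t_def K_def sum.distrib using sym by (metis (no_types, lifting) sum.cong)
    then show ?thesis by (simp add: sum0 that)
  qed
  have tK: "K b c * t a b c = t a b c * L a b c" for a b c
    by (auto simp: L_def t_def zero)
  have GK: "K b c * G a b c = G a b c * L a b c" for a b c
    by (auto simp: L_def zero)
  have GL: "cube_sum T (\<lambda>a b c. G a b c * L a b c) = \<kappa>"
    using cube_sum_first[of T K G] by (simp add: GK \<kappa>_def flip: K_def)
  have tL: "cube_sum T (\<lambda>a b c. t a b c * L a b c) = \<kappa>"
    using cube_sum_first[of T K t] by (simp add: tK \<kappa>_def tsum)
  have LL: "cube_sum T (\<lambda>a b c. L a b c * L a b c) = (v - 2) * \<kappa>"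
  proof -
    have "cube_sum T (\<lambda>a b c. L a b c * L a b c)
      = cube_sum T (\<lambda>a b c. K b c * L a b c)"
      by (intro cube_sum_cong) (simp add: L_def)
    also have "\<dots> = (\<Sum>b\<in>T. \<Sum>c\<in>T. K b c * (\<Sum>a\<in>T. L a b c))" by (rule cube_sum_first)
    also have "\<dots> = (\<Sum>b\<in>T. \<Sum>c\<in>T. (v - 2) * (K b c * K b c))"
    proof (intro sum.cong refl)
      fix b c assume bc: "b \<in> T" "c \<in> T"
      show "K b c * (\<Sum>a\<in>T. L a b c) = (v - 2) * (K b c * K b c)"
      proof (cases "b = c")
        case False
        have "(\<Sum>a\<in>T. L a b c) = (\<Sum>a\<in>T - {b, c}. K b c)"
          using fin by (intro sum.mono_neutral_cong_right) (auto simp: L_def)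
        also have "\<dots> = (v - 2) * K b c"
          using bc False fin card by (simp add: v_def card_Diff_subset of_nat_diff)
        finally show ?thesis by simp
      qed (simp add: K0)
    qed
    also have "\<dots> = (v - 2) * \<kappa>" by (simp add: \<kappa>_def sum_distrib_left)
    finally show ?thesis .
  qed
  \<comment> \<open>For fixed \<open>a\<close> and \<open>c\<close>, the sum of \<open>K c b\<close>
    over \<open>b\<close> other than \<open>a\<close> is \<open>- K a c\<close>, because the full
    sum is zero.\<close>
  have LL12: "cube_sum T (\<lambda>a b c. L a b c * L b a c) = - \<kappa>"
  proof -
    have "cube_sum T (\<lambda>a b c. L a b c * L b a c) = cube_sum T (\<lambda>a c b. L a b c * L b a c)"
      by (rule cube_sum_swap23)
    also have "\<dots> = cube_sum T (\<lambda>a c b. K a c * (if b = a then 0 else K c b))"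
      by (intro cube_sum_cong) (auto simp: L_def K0 Ksym)
    also have "\<dots> = (\<Sum>a\<in>T. \<Sum>c\<in>T. K a c * (\<Sum>b\<in>T. if b = a then 0 else K c b))"
      by (rule cube_sum_last)
    also have "\<dots> = (\<Sum>a\<in>T. \<Sum>c\<in>T. - (K a c * K a c))"
    proof (intro sum.cong refl)
      fix a c assume ac: "a \<in> T" "c \<in> T"
      have "(\<Sum>b\<in>T. if b = a then 0 else K c b) = (\<Sum>b\<in>T - {a}. K c b)"
        using fin by (intro sum.mono_neutral_cong_right) auto
      also have "\<dots> = - K a c"
        using fin ac Ksum[of c] by (simp add: sum_diff1 Ksym[of a c])
      finally show "K a c * (\<Sum>b\<in>T. if b = a then 0 else K c b) = - (K a c * K a c)" by simp
    qed
    also have "\<dots> = - \<kappa>" by (simp add: \<kappa>_def sum_negf)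
    finally show ?thesis .
  qed
  have Lsym: "L a b c = L a c b" for a b c by (auto simp: L_def Ksym)
  have Gt: "cube_sum T (\<lambda>a b c. G a b c * t a b c) = P / 3"
  proof -
    have 1: "cube_sum T (\<lambda>a b c. G b a c * t a b c) = cube_sum T (\<lambda>a b c. G a b c * t a b c)"
      by (subst cube_sum_swap12) (simp add: t12)
    have 2: "cube_sum T (\<lambda>a b c. G c a b * t a b c) = cube_sum T (\<lambda>a b c. G b a c * t a b c)"
      by (subst cube_sum_swap23) (simp add: t23)
    have "P = cube_sum T (\<lambda>a b c. G a b c * t a b c + G b a c * t a b c + G c a b * t a b c)"
      unfolding P_def by (intro cube_sum_cong) (simp add: t_def algebra_simps)
    then show ?thesis by (simp add: cube_sum_add 1 2)
  qed
  \<comment> \<open>Cauchy-Schwarz for \<open>t\<close> and the symmetrised \<open>M\<close>: their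
    inner product is \<open>3 * \<kappa>\<close> and the squared norm of \<open>M\<close> is
    \<open>3 * (v - 4) * \<kappa>\<close>. This suggests the square of
    \<open>(v - 4) * t - M\<close>, and \<open>v > 4\<close> allows the final division.\<close>
  have PK: "(v - 4) * P \<ge> 3 * \<kappa>"
  proof -
    define M where "M a b c = L a b c + L b a c + L c a b" for a b c
    have t2: "cube_sum T (\<lambda>a b c. t a b c * L b a c) = \<kappa>"
      by (subst cube_sum_swap12) (simp add: t12 tL)
    have t3: "cube_sum T (\<lambda>a b c. t a b c * L c a b) = \<kappa>"
      by (subst cube_sum_swap23) (simp add: t23 t2)
    have l2: "cube_sum T (\<lambda>a b c. L b a c * L b a c) = (v - 2) * \<kappa>"
      by (subst cube_sum_swap12) (simp add: LL)
    have l3: "cube_sum T (\<lambda>a b c. L c a b * L c a b) = (v - 2) * \<kappa>"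
      by (subst cube_sum_swap23) (simp add: l2)
    have l13: "cube_sum T (\<lambda>a b c. L a b c * L c a b) = - \<kappa>"
      using LL12 by (subst cube_sum_swap23) (simp add: Lsym[of b a c for a b c] Lsym[of b c a for a b c])
    have l23: "cube_sum T (\<lambda>a b c. L b a c * L c a b) = - \<kappa>"
      by (subst cube_sum_swap12) (use l13 Lsym in simp)
    have "0 \<le> cube_sum T (\<lambda>a b c. ((v - 4) * t a b c - M a b c)\<^sup>2)"
      by (rule cube_sum_nonneg) simp
    also have "\<dots> = cube_sum T (\<lambda>a b c. (v - 4)\<^sup>2 * (t a b c * t a b c)
        - 2 * (v - 4) * (t a b c * L a b c + t a b c * L b a c + t a b c * L c a b)
        + (L a b c * L a b c + L b a c * L b a c + L c a b * L c a b)
        + 2 * (L a b c * L b a c + L a b c * L c a b + L b a c * L c a b))"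
      by (intro cube_sum_cong) (simp add: M_def power2_eq_square algebra_simps)
    also have "\<dots> = (v - 4)\<^sup>2 * P - 2 * (v - 4) * (3 * \<kappa>) + 3 * (v - 2) * \<kappa> - 6 * \<kappa>"
      by (simp add: cube_sum_add cube_sum_diff cube_sum_cmult t2 t3 l2 l3 l13 l23 LL LL12 tL
        flip: P_def)
    also have "\<dots> = (v - 4) * ((v - 4) * P - 3 * \<kappa>)"
      by (simp add: power2_eq_square algebra_simps)
    finally show ?thesis using v by (simp add: zero_le_mult_iff)
  qed
  \<comment> \<open>Expanding the square of \<open>(v - 1) * G - (t + L)\<close> gives the desired
    difference times \<open>v - 1\<close>, minus a third of the quantity that \<open>PK\<close>
    shows to be nonnegative.\<close>
  have main: "P / 3 + \<kappa> \<le> (v - 1) * g"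
  proof -
    have "0 \<le> cube_sum T (\<lambda>a b c. ((v - 1) * G a b c - (t a b c + L a b c))\<^sup>2)"
      by (rule cube_sum_nonneg) simp
    also have "\<dots> = cube_sum T (\<lambda>a b c. (v - 1)\<^sup>2 * (G a b c * G a b c)
        - 2 * (v - 1) * (G a b c * t a b c + G a b c * L a b c)
        + (t a b c * t a b c + 2 * (t a b c * L a b c) + L a b c * L a b c))"
      by (intro cube_sum_cong) (simp add: power2_eq_square algebra_simps)
    also have "\<dots> = (v - 1)\<^sup>2 * g - 2 * (v - 1) * (P / 3 + \<kappa>) + (P + 2 * \<kappa> + (v - 2) * \<kappa>)"
      by (simp only: cube_sum_add cube_sum_diff cube_sum_cmult Gt GL LL tL flip: P_def g_def)
    also have "\<dots> = (v - 1) * ((v - 1) * g - (P / 3 + \<kappa>)) - ((v - 4) * P - 3 * \<kappa>) / 3"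
      by (simp add: power2_eq_square field_simps)
    finally have "0 \<le> (v - 1) * ((v - 1) * g - (P / 3 + \<kappa>))" using PK by simp
    then show ?thesis using v by (simp add: zero_le_mult_iff)
  qed
  have "cube_sum T (\<lambda>a b c. G a b c * (G b a c + G c b a + (\<Sum>w\<in>T. G w b c) - G a b c))
    = cube_sum T (\<lambda>a b c. G a b c * t a b c + G a b c * L a b c - 2 * (G a b c * G a b c))"
    by (intro cube_sum_cong)
      (simp add: GK[symmetric] t_def algebra_simps sym[of c b a for a b c] flip: K_def)
  also have "\<dots> = P / 3 + \<kappa> - 2 * g"
    by (simp only: cube_sum_add cube_sum_diff cube_sum_cmult Gt GL flip: g_def)
  also have "\<dots> \<le> (v - 3) * g" using main by (simp add: algebra_simps)
  finally show ?thesis by (simp add: v_def g_def power2_eq_square)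
qed

section \<open>The norm of the move operator\<close>

lemma triple_sum_const:
  assumes "finite T" "\<And>a b c. a = b \<or> a = c \<or> b = c \<Longrightarrow> \<phi> a b c = 0"
    and "\<And>a b c. \<lbrakk>a \<in> T; b \<in> T; c \<in> T; a \<noteq> b; a \<noteq> c; b \<noteq> c\<rbrakk> \<Longrightarrow> real (card (pms (T - {a, b, c}))) = \<mu>"
  shows "triple_sum T (\<lambda>a b c m. \<phi> a b c) = \<mu> * cube_sum T \<phi>"
proof -
  have "triple_sum T (\<lambda>a b c m. \<phi> a b c) = (\<Sum>a\<in>T. \<Sum>b\<in>T - {a}. \<Sum>c\<in>T - {a, b}. \<mu> * \<phi> a b c)"
    unfolding triple_sum_def using assms(3) by (intro sum.cong refl) auto
  also have "\<dots> = (\<Sum>a\<in>T. \<Sum>b\<in>T. \<Sum>c\<in>T. \<mu> * \<phi> a b c)"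
  proof (rule sum.cong[OF refl])
    fix a
    have "(\<Sum>b\<in>T - {a}. \<Sum>c\<in>T - {a, b}. \<mu> * \<phi> a b c) = (\<Sum>b\<in>T - {a}. \<Sum>c\<in>T. \<mu> * \<phi> a b c)"
      using assms(1,2) by (intro sum.cong[OF refl] sum.mono_neutral_left) auto
    also have "\<dots> = (\<Sum>b\<in>T. \<Sum>c\<in>T. \<mu> * \<phi> a b c)"
      using assms(1,2) by (intro sum.mono_neutral_left) auto
    finally show "(\<Sum>b\<in>T - {a}. \<Sum>c\<in>T - {a, b}. \<mu> * \<phi> a b c) = (\<Sum>b\<in>T. \<Sum>c\<in>T. \<mu> * \<phi> a b c)" .
  qed
  finally show ?thesis by (simp add: cube_sum_def sum_distrib_left)
qed

text \<open>Two vertices have only one perfect matching; this settles the base cases of the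
  inductions.\<close>

lemma pms_card2_zero:
  fixes f :: "'a set set \<Rightarrow> real"
  assumes "finite U" "card U = 2" "(\<Sum>m\<in>pms U. f m) = 0" "m \<in> pms U"
  shows "f m = 0"
proof -
  have "card (pms U) = 1" using card_pms[of U 1] assms by simp
  then obtain m0 where "pms U = {m0}" by (auto simp: card_1_singleton_iff)
  then show ?thesis using assms by simp
qed

text \<open>A move to \<open>b\<close> or \<open>c\<close> breaks the edge \<open>{b, c}\<close>;
  every other move keeps it and takes place within \<open>T - {b, c}\<close>.\<close>

lemma move_insert:
  assumes "finite T" "a \<in> T" "b \<in> T" "c \<in> T" "a \<noteq> b" "a \<noteq> c" "b \<noteq> c" "m \<in> pms (T - {a, b, c})"
  shows "move T f a (insert {b, c} m)
    = f b (insert {a, c} m) + f c (insert {b, a} m)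
      + move (T - {b, c}) (\<lambda>w m. f w (insert {b, c} m)) a m"
proof -
  have "T - {a} = insert b (insert c (T - {b, c} - {a}))" using assms by auto
  moreover have "swap a b (insert {b, c} m) = insert {a, c} m"
    using assms by (intro swap_insert) auto
  moreover have "swap a c (insert {c, b} m) = insert {a, b} m"
    using assms by (intro swap_insert[of m T]) (auto simp: insert_commute)
  moreover have "(\<Sum>w\<in>T - {b, c} - {a}. f w (swap a w (insert {b, c} m)))
    = (\<Sum>w\<in>T - {b, c} - {a}. f w (insert {b, c} (swap a w m)))"
    using assms by (intro sum.cong refl) (auto simp: relabel_insert transpose_apply_other)
  ultimately show ?thesis
    using assms by (simp add: move_def insert_commute[of c b] insert_commute[of b a])
qed

text \<open>Fix a matched edge \<open>{b, c}\<close> and split \<open>f\<close> into its mean \<open>G\<close> over all matchings of the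
  remaining vertices and the deviation \<open>F0\<close> from it. The induction hypothesis, on \<open>T - {b, c}\<close>,
  controls the deviation, up to the two moves that destroy \<open>{b, c}\<close>; the mean is a function of
  three vertices.\<close>

lemma move_upper:
  assumes "k \<ge> 1" "finite T" "card T = 2 * k + 1"
    and "\<And>a. a \<in> T \<Longrightarrow> (\<Sum>m\<in>pms (T - {a}). f a m) = 0"
  shows "near_sum T (\<lambda>a m. f a m * move T f a m)
    \<le> (2 * real k - 2) * near_sum T (\<lambda>a m. (f a m)\<^sup>2)"
  using assms
proof (induction k arbitrary: T f rule: nat_induct_at_least)
  case base
  have "f a m = 0" if "a \<in> T" "m \<in> pms (T - {a})" for a m
    using pms_card2_zero[of "T - {a}" "f a" m] base.prems that by simp
  then have "near_sum T (\<lambda>a m. f a m * move T f a m) = near_sum T (\<lambda>a m. 0)"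
    by (intro near_sum_cong) simp
  then show ?case by (simp add: near_sum_def)
next
  case (Suc k)
  note fin = \<open>finite T\<close>
  define \<mu> where "\<mu> = real (double_fact (2 * k - 1))"
  have \<mu>: "\<mu> > 0" by (simp add: \<mu>_def double_fact_pos)
  have card_link: "real (card (pms (T - {a, b, c}))) = \<mu>"
    if "a \<in> T" "b \<in> T" "c \<in> T" "a \<noteq> b" "a \<noteq> c" "b \<noteq> c" for a b c
    unfolding \<mu>_def using that Suc.prems
    by (subst card_pms[where k = k]) (auto simp: card_Diff_subset)
  define F where "F a b c m = f a (insert {b, c} m)" for a b c m
  \<comment> \<open>The value 0 at repeated vertices lets the sums below run over all of
    \<open>T\<close>.\<close>
  define G where "G a b c = (if a = b \<or> a = c \<or> b = c then 0
    else (\<Sum>m\<in>pms (T - {a, b, c}). F a b c m) / \<mu>)" for a b c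
  define F0 where "F0 a b c m = F a b c m - G a b c" for a b c m
  have F_eq: "F a b c m = F0 a b c m + G a b c" for a b c m by (simp add: F0_def)
  have Fsym: "F a c b m = F a b c m" for a b c m by (simp add: F_def insert_commute)
  have Gsym: "G a c b = G a b c" for a b c
  proof -
    have *: "{a, c, b} = {a, b, c}" by blast
    show ?thesis unfolding G_def * Fsym[of a b c] by (rule if_cong) auto
  qed
  have G0: "G a b c = 0" if "a = b \<or> a = c \<or> b = c" for a b c using that by (simp add: G_def)
  have F0sum: "(\<Sum>m\<in>pms (T - {a, b, c}). F0 a b c m) = 0"
    if "a \<in> T" "b \<in> T" "c \<in> T" "a \<noteq> b" "a \<noteq> c" "b \<noteq> c" for a b c
    using card_link[OF that] \<mu> that by (simp add: F0_def sum_subtractf G_def)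
  \<comment> \<open>Summing over the partner \<open>q\<close> of \<open>p\<close> collects every
    matching missing \<open>a\<close>, and \<open>f\<close> has sum zero over these.\<close>
  have Gsum: "(\<Sum>q\<in>T. G a p q) = 0" if "a \<in> T" "p \<in> T" for a p
  proof (cases "a = p")
    case False
    have *: "T - {a} - {p} = T - {a, p}" "T - {a} - {p, q} = T - {a, p, q}" for q by blast+
    have "(\<Sum>q\<in>T. G a p q) = (\<Sum>q\<in>T - {a, p}. (\<Sum>m\<in>pms (T - {a, p, q}). F a p q m) / \<mu>)"
      using fin False by (intro sum.mono_neutral_cong_right) (auto simp: G_def)
    also have "\<dots> = (\<Sum>m\<in>pms (T - {a}). f a m) / \<mu>"
      using sum_pms_partner[of "T - {a}" p "f a"] fin that False
      by (simp add: * F_def sum_divide_distrib)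
    finally show ?thesis using Suc.prems(3)[OF that(1)] by simp
  qed (simp add: G_def)

  define N0 where "N0 = triple_sum T (\<lambda>a b c m. (F0 a b c m)\<^sup>2)"
  define NG where "NG = triple_sum T (\<lambda>a b c m. (G a b c)\<^sup>2)"
  define S0 where "S0 = triple_sum T (\<lambda>a b c m. F0 a b c m * F0 b a c m)"
  define SG where "SG = triple_sum T (\<lambda>a b c m. G a b c * G b a c)"
  define LG where "LG = triple_sum T (\<lambda>a b c m. G a b c * ((\<Sum>w\<in>T. G w b c) - G a b c))"
  define L0 where "L0 = (\<Sum>b\<in>T. \<Sum>c\<in>T - {b}. near_sum (T - {b, c})
    (\<lambda>a m. F0 a b c m * move (T - {b, c}) (\<lambda>w m. F0 w b c m) a m))"
  define LF where "LF = (\<Sum>b\<in>T. \<Sum>c\<in>T - {b}. near_sum (T - {b, c})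
    (\<lambda>a m. F a b c m * move (T - {b, c}) (\<lambda>w m. F w b c m) a m))"

  have norm: "2 * real (Suc k) * near_sum T (\<lambda>a m. (f a m)\<^sup>2) = N0 + NG"
  proof -
    have "2 * real (Suc k) * near_sum T (\<lambda>a m. (f a m)\<^sup>2) = triple_sum T (\<lambda>a b c m. (F a b c m)\<^sup>2)"
      unfolding F_def using Suc.prems by (intro near_sum_to_triple) auto
    also have "\<dots> = triple_sum T (\<lambda>a b c m. (F0 a b c m)\<^sup>2 + (G a b c)\<^sup>2 + 2 * (F0 a b c m * G a b c))"
      by (intro triple_sum_cong) (simp add: F_eq power2_sum)
    also have "\<dots> = N0 + NG + 2 * triple_sum T (\<lambda>a b c m. F0 a b c m * G a b c)"
      by (simp only: triple_sum_add triple_sum_cmult N0_def NG_def)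
    also have "triple_sum T (\<lambda>a b c m. F0 a b c m * G a b c) = 0"
      by (rule triple_sum_zero) (simp add: F0sum flip: sum_distrib_right)
    finally show ?thesis by simp
  qed

  have swap_split: "triple_sum T (\<lambda>a b c m. F a b c m * F b a c m) = S0 + SG"
  proof -
    have "triple_sum T (\<lambda>a b c m. F a b c m * F b a c m)
      = triple_sum T (\<lambda>a b c m. F0 a b c m * F0 b a c m + G a b c * G b a c
          + (F0 a b c m * G b a c + G a b c * F0 b a c m))"
      by (intro triple_sum_cong) (simp add: F_eq algebra_simps)
    also have "\<dots> = S0 + SG + triple_sum T (\<lambda>a b c m. F0 a b c m * G b a c + G a b c * F0 b a c m)"
      by (simp only: triple_sum_add S0_def SG_def)
    also have "triple_sum T (\<lambda>a b c m. F0 a b c m * G b a c + G a b c * F0 b a c m) = 0"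
    proof (rule triple_sum_zero)
      fix a b c assume "a \<in> T" "b \<in> T" "c \<in> T" "a \<noteq> b" "a \<noteq> c" "b \<noteq> c"
      then show "(\<Sum>m\<in>pms (T - {a, b, c}). F0 a b c m * G b a c + G a b c * F0 b a c m) = 0"
        using F0sum[of a b c] F0sum[of b a c]
        by (simp add: sum.distrib insert_commute[of b a] flip: sum_distrib_left sum_distrib_right)
    qed
    finally show ?thesis by simp
  qed

  have link_split: "LF = L0 + LG"
  proof -
    have "LF = (\<Sum>b\<in>T. \<Sum>c\<in>T - {b}.
        near_sum (T - {b, c}) (\<lambda>a m. F0 a b c m * move (T - {b, c}) (\<lambda>w m. F0 w b c m) a m)
        + near_sum (T - {b, c}) (\<lambda>a m. G a b c * (\<Sum>w\<in>T - {b, c} - {a}. G w b c)))"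
      unfolding LF_def F_eq
    proof (intro sum.cong refl near_sum_move_split)
      fix b c a assume "b \<in> T" "c \<in> T - {b}" "a \<in> T - {b, c}"
      moreover have "T - {b, c} - {a} = T - {a, b, c}" by blast
      ultimately show "(\<Sum>m\<in>pms (T - {b, c} - {a}). F0 a b c m) = 0" using F0sum[of a b c] by auto
    qed (use fin in simp)
    also have "\<dots> = L0 + (\<Sum>b\<in>T. \<Sum>c\<in>T - {b}.
        near_sum (T - {b, c}) (\<lambda>a m. G a b c * (\<Sum>w\<in>T - {b, c} - {a}. G w b c)))"
      by (simp add: sum.distrib L0_def)
    also have "(\<Sum>b\<in>T. \<Sum>c\<in>T - {b}.
        near_sum (T - {b, c}) (\<lambda>a m. G a b c * (\<Sum>w\<in>T - {b, c} - {a}. G w b c)))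
      = triple_sum T (\<lambda>a b c m. G a b c * (\<Sum>w\<in>T - {b, c} - {a}. G w b c))"
      by (rule triple_sum_link[OF fin, symmetric])
    also have "\<dots> = LG"
      unfolding LG_def
    proof (intro triple_sum_cong arg_cong2[where f = times] refl)
      fix a b c assume "a \<in> T" "b \<in> T" "c \<in> T" "a \<noteq> b" "a \<noteq> c" "b \<noteq> c"
      have "(\<Sum>w\<in>T - {b, c} - {a}. G w b c) = (\<Sum>w\<in>T - {a}. G w b c)"
        using fin by (intro sum.mono_neutral_left) (auto simp: G0)
      then show "(\<Sum>w\<in>T - {b, c} - {a}. G w b c) = (\<Sum>w\<in>T. G w b c) - G a b c"
        using fin \<open>a \<in> T\<close> by (simp add: sum_diff1)
    qed
    finally show ?thesis .
  qed

  \<comment> \<open>The two moves that break \<open>{b, c}\<close> contribute equally, by exchanging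
    \<open>b\<close> and \<open>c\<close>; the moves that keep it make up \<open>LF\<close>.\<close>
  have form: "2 * real (Suc k) * near_sum T (\<lambda>a m. f a m * move T f a m)
    = (2 * S0 + L0) + (2 * SG + LG)"
  proof -
    have "2 * real (Suc k) * near_sum T (\<lambda>a m. f a m * move T f a m)
      = triple_sum T (\<lambda>a b c m. f a (insert {b, c} m) * move T f a (insert {b, c} m))"
      using Suc.prems by (intro near_sum_to_triple) auto
    also have "\<dots> = triple_sum T (\<lambda>a b c m. F a b c m * F b a c m + F a b c m * F c b a m
        + F a b c m * move (T - {b, c}) (\<lambda>w m. F w b c m) a m)"
      using fin by (intro triple_sum_cong) (simp add: move_insert F_def algebra_simps)
    also have "\<dots> = triple_sum T (\<lambda>a b c m. F a b c m * F b a c m)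
        + triple_sum T (\<lambda>a b c m. F a b c m * F c b a m) + LF"
      by (simp only: triple_sum_add LF_def triple_sum_link[OF fin,
            of "\<lambda>a b c m. F a b c m * move (T - {b, c}) (\<lambda>w m. F w b c m) a m"])
    also have "triple_sum T (\<lambda>a b c m. F a b c m * F c b a m)
        = triple_sum T (\<lambda>a b c m. F a b c m * F b a c m)"
      by (subst triple_sum_swap23[OF fin]) (simp add: Fsym[of _ b c for b c])
    finally show ?thesis using swap_split link_split by simp
  qed

  \<comment> \<open>The factor from the three-vertex form is \<open>card T - 3\<close>, which is
    \<open>2 * k\<close> because \<open>card T = 2 * Suc k + 1\<close>.\<close>
  have mean_part: "2 * SG + LG \<le> 2 * real k * NG"
  proof -
    have SG': "triple_sum T (\<lambda>a b c m. G a b c * G c b a) = SG"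
      unfolding SG_def by (subst triple_sum_swap23[OF fin]) (simp add: Gsym)
    have "2 * SG + LG = triple_sum T (\<lambda>a b c m. G a b c * G b a c + G a b c * G c b a
        + G a b c * ((\<Sum>w\<in>T. G w b c) - G a b c))"
      by (simp only: triple_sum_add LG_def SG') (simp add: SG_def)
    also have "\<dots> = triple_sum T (\<lambda>a b c m.
        G a b c * (G b a c + G c b a + (\<Sum>w\<in>T. G w b c) - G a b c))"
      by (intro triple_sum_cong) (simp add: algebra_simps)
    also have "\<dots> = \<mu> * cube_sum T (\<lambda>a b c.
        G a b c * (G b a c + G c b a + (\<Sum>w\<in>T. G w b c) - G a b c))"
      using fin card_link by (intro triple_sum_const) (auto simp: G0)
    also have "\<dots> \<le> \<mu> * ((real (card T) - 3) * cube_sum T (\<lambda>a b c. (G a b c)\<^sup>2))"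
    proof (intro mult_left_mono cube_form_bound)
      show "card T \<ge> 5" using Suc by simp
    qed (use fin G0 Gsym Gsum \<mu> in auto)
    also have "\<dots> = 2 * real k * (\<mu> * cube_sum T (\<lambda>a b c. (G a b c)\<^sup>2))"
      using Suc.prems by simp
    also have "\<mu> * cube_sum T (\<lambda>a b c. (G a b c)\<^sup>2) = NG"
      unfolding NG_def using fin card_link by (intro triple_sum_const[symmetric]) (auto simp: G0)
    finally show ?thesis .
  qed

  \<comment> \<open>The breaking moves cost at most \<open>2 * N0\<close> and the induction
    hypothesis gives \<open>2 * k - 2\<close> for the others, together exactly
    \<open>2 * k\<close>.\<close>
  have deviation_part: "2 * S0 + L0 \<le> 2 * real k * N0"
  proof -
    have "triple_sum T (\<lambda>a b c m. (F0 b a c m)\<^sup>2) = N0"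
      unfolding N0_def by (rule triple_sum_swap12[OF fin, symmetric])
    then have "2 * N0 - 2 * S0 = triple_sum T (\<lambda>a b c m.
        (F0 a b c m)\<^sup>2 + (F0 b a c m)\<^sup>2 - 2 * (F0 a b c m * F0 b a c m))"
      by (simp only: triple_sum_add triple_sum_diff triple_sum_cmult N0_def S0_def)
    also have "\<dots> = triple_sum T (\<lambda>a b c m. (F0 a b c m - F0 b a c m)\<^sup>2)"
      by (intro triple_sum_cong) (simp add: power2_diff)
    also have "\<dots> \<ge> 0" by (rule triple_sum_nonneg) simp
    finally have S0_le: "S0 \<le> N0" by simp
    have "L0 \<le> (\<Sum>b\<in>T. \<Sum>c\<in>T - {b}.
        (2 * real k - 2) * near_sum (T - {b, c}) (\<lambda>a m. (F0 a b c m)\<^sup>2))"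
      unfolding L0_def
    proof (intro sum_mono Suc.IH)
      fix b c assume bc: "b \<in> T" "c \<in> T - {b}"
      then show "card (T - {b, c}) = 2 * k + 1"
        using Suc.prems by (auto simp: card_Diff_subset)
      fix a assume "a \<in> T - {b, c}"
      moreover have "T - {b, c} - {a} = T - {a, b, c}" by blast
      ultimately show "(\<Sum>m\<in>pms (T - {b, c} - {a}). F0 a b c m) = 0"
        using bc F0sum[of a b c] by auto
    qed (use fin in simp)
    also have "\<dots> = (2 * real k - 2) * N0"
      by (simp add: N0_def triple_sum_link[OF fin] sum_distrib_left)
    finally show ?thesis using S0_le by (simp add: algebra_simps)
  qed

  have "2 * real (Suc k) * near_sum T (\<lambda>a m. f a m * move T f a m) \<le> 2 * real k * (N0 + NG)"
    using form mean_part deviation_part by (simp add: algebra_simps)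
  also have "\<dots> = 2 * real (Suc k) * ((2 * real (Suc k) - 2) * near_sum T (\<lambda>a m. (f a m)\<^sup>2))"
    using norm by simp
  finally show ?case by (subst (asm) mult_le_cancel_left_pos) auto
qed

text \<open>Write \<open>g\<close> for \<open>move T f\<close>. Self-adjointness turns the form at
  \<open>g + r * f\<close> minus the form at \<open>g - r * f\<close> into \<open>4 * r\<close>
  times the squared norm of \<open>g\<close>. Bounding the first form above and the second below by
  \<open>r\<close> times the squared norms gives the claim.\<close>

lemma move_norm:
  assumes "k \<ge> 2" "finite T" "card T = 2 * k + 1"
    and f: "\<And>a. a \<in> T \<Longrightarrow> (\<Sum>m\<in>pms (T - {a}). f a m) = 0"
  shows "near_sum T (\<lambda>a m. (move T f a m)\<^sup>2)
    \<le> (2 * real k - 2)\<^sup>2 * near_sum T (\<lambda>a m. (f a m)\<^sup>2)"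
proof -
  define r where "r = 2 * real k - 2"
  have r: "r > 0" using assms(1) by (simp add: r_def)
  define g where "g = move T f"
  have g: "(\<Sum>m\<in>pms (T - {a}). g a m) = 0" if "a \<in> T" for a
    unfolding g_def by (rule sum_move_zero[OF assms(2) that f])
  define x where "x a m = g a m + r * f a m" for a m
  define y where "y a m = g a m - r * f a m" for a m
  define gg where "gg = near_sum T (\<lambda>a m. g a m * g a m)"
  define gf where "gf = near_sum T (\<lambda>a m. g a m * f a m)"
  define ff where "ff = near_sum T (\<lambda>a m. f a m * f a m)"
  have "near_sum T (\<lambda>a m. x a m * move T x a m) \<le> r * near_sum T (\<lambda>a m. (x a m)\<^sup>2)"
    unfolding r_def using assms f g
    by (intro move_upper) (simp_all add: x_def sum.distrib flip: sum_distrib_left)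
  moreover have "- r * near_sum T (\<lambda>a m. (y a m)\<^sup>2) \<le> near_sum T (\<lambda>a m. y a m * move T y a m)"
  proof -
    \<comment> \<open>The lower bound \<open>- k\<close> is good enough because
      \<open>k \<ge> 2\<close> gives \<open>k \<le> 2 * k - 2\<close>.\<close>
    have "- r * near_sum T (\<lambda>a m. (y a m)\<^sup>2) \<le> - real k * near_sum T (\<lambda>a m. (y a m)\<^sup>2)"
      using assms(1) by (intro mult_right_mono near_sum_nonneg) (auto simp: r_def)
    also have "\<dots> \<le> near_sum T (\<lambda>a m. y a m * move T y a m)"
      by (rule move_lower[OF assms(2,3)])
    finally show ?thesis .
  qed
  moreover have "near_sum T (\<lambda>a m. x a m * move T x a m) - near_sum T (\<lambda>a m. y a m * move T y a m)
    = 4 * r * gg"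
  proof -
    have "near_sum T (\<lambda>a m. x a m * move T x a m) - near_sum T (\<lambda>a m. y a m * move T y a m)
      = near_sum T (\<lambda>a m. 2 * r * (g a m * move T f a m) + 2 * r * (f a m * move T g a m))"
      unfolding near_sum_diff[symmetric]
    proof (rule near_sum_cong)
      fix a m
      have "move T x a m = move T g a m + r * move T f a m"
        "move T y a m = move T g a m - r * move T f a m"
        by (simp_all add: move_def x_def y_def sum.distrib sum_subtractf sum_distrib_left)
      then show "x a m * move T x a m - y a m * move T y a m
        = 2 * r * (g a m * move T f a m) + 2 * r * (f a m * move T g a m)"
        unfolding x_def[of a m] y_def[of a m] by (simp only:) (simp add: algebra_simps)
    qed
    also have "\<dots> = 2 * r * near_sum T (\<lambda>a m. g a m * move T f a m)
        + 2 * r * near_sum T (\<lambda>a m. f a m * move T g a m)"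
      by (simp only: near_sum_add near_sum_cmult)
    also have "near_sum T (\<lambda>a m. f a m * move T g a m) = near_sum T (\<lambda>a m. g a m * move T f a m)"
      by (rule move_selfadjoint[OF assms(2)])
    finally show ?thesis by (simp add: gg_def g_def)
  qed
  moreover have "near_sum T (\<lambda>a m. (x a m)\<^sup>2) + near_sum T (\<lambda>a m. (y a m)\<^sup>2)
    = 2 * gg + 2 * r\<^sup>2 * ff"
  proof -
    have "near_sum T (\<lambda>a m. (x a m)\<^sup>2) + near_sum T (\<lambda>a m. (y a m)\<^sup>2)
      = near_sum T (\<lambda>a m. 2 * (g a m * g a m) + 2 * r\<^sup>2 * (f a m * f a m))"
      unfolding near_sum_add[symmetric]
      by (intro near_sum_cong) (simp add: x_def y_def power2_eq_square algebra_simps)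
    then show ?thesis by (simp only: near_sum_add near_sum_cmult gg_def ff_def)
  qed
  then have "r * near_sum T (\<lambda>a m. (x a m)\<^sup>2) + r * near_sum T (\<lambda>a m. (y a m)\<^sup>2)
    = r * (2 * gg + 2 * r\<^sup>2 * ff)" by (simp only: distrib_left[symmetric])
  ultimately have "4 * r * gg \<le> r * (2 * gg + 2 * r\<^sup>2 * ff)" by linarith
  then have "r * (4 * gg) \<le> r * (2 * gg + 2 * r\<^sup>2 * ff)" by (simp add: mult_ac)
  then have "4 * gg \<le> 2 * gg + 2 * r\<^sup>2 * ff" using r by (simp only: mult_le_cancel_left_pos)
  then show ?thesis by (simp add: gg_def ff_def g_def r_def power2_eq_square)
qed

section \<open>The graph of Hamiltonian unions\<close>

definition ham :: "'a set \<Rightarrow> ('a set set \<Rightarrow> real) \<Rightarrow> 'a set set \<Rightarrow> real" where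
  "ham S f x = (\<Sum>y\<in>pms S. of_bool (joined S x y) * f y)"

lemma ham_diff: "ham S (\<lambda>x. f x - g x) x = ham S f x - ham S g x"
  by (simp add: ham_def algebra_simps sum_subtractf)

text \<open>A neighbour of \<open>insert {p, a} m\<close> matches \<open>p\<close> to some
  \<open>w\<close> other than \<open>a\<close>, since a common edge disconnects the union.
  Contracting \<open>w - p - a\<close> and reindexing by \<open>swap a w\<close> leaves a neighbour
  of \<open>m\<close> on \<open>S - {p, a}\<close>.\<close>

lemma ham_insert:
  assumes "finite S" "card S > 2" "p \<in> S" "a \<in> S - {p}" "m \<in> pms (S - {p, a})"
  shows "ham S f (insert {p, a} m)
    = ham (S - {p, a}) (move (S - {p}) (\<lambda>w m. f (insert {p, w} m)) a) m"
proof -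
  have *: "S - {p} - {w} = S - {p, w}" for w by blast
  have "ham S f (insert {p, a} m) = (\<Sum>w\<in>S - {p}. \<Sum>m2\<in>pms (S - {p, w}).
      of_bool (joined S (insert {p, a} m) (insert {p, w} m2)) * f (insert {p, w} m2))"
    unfolding ham_def by (rule sum_pms_partner[OF assms(1,3)])
  also have "\<dots> = (\<Sum>w\<in>S - {p} - {a}. \<Sum>m2\<in>pms (S - {p, w}).
      of_bool (joined S (insert {p, a} m) (insert {p, w} m2)) * f (insert {p, w} m2))"
  proof (rule sum.mono_neutral_right)
    show "\<forall>w\<in>S - {p} - (S - {p} - {a}). (\<Sum>m2\<in>pms (S - {p, w}).
      of_bool (joined S (insert {p, a} m) (insert {p, w} m2)) * f (insert {p, w} m2)) = 0"
      using assms by (auto intro!: sum.neutral simp: joined_common_edge)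
  qed (use assms in auto)
  also have "\<dots> = (\<Sum>w\<in>S - {p} - {a}. \<Sum>m2\<in>pms (S - {p, w}).
      of_bool (joined (S - {p, a}) m (swap a w m2)) * f (insert {p, w} m2))"
  proof (intro sum.cong refl)
    fix w m2 assume "w \<in> S - {p} - {a}" "m2 \<in> pms (S - {p, w})"
    then have "joined S (insert {p, a} m) (insert {p, w} m2)
      = joined (S - {p, a}) m (swap a w m2)"
      using assms by (intro joined_contract) auto
    then show "of_bool (joined S (insert {p, a} m) (insert {p, w} m2)) * f (insert {p, w} m2)
      = of_bool (joined (S - {p, a}) m (swap a w m2)) * f (insert {p, w} m2)" by simp
  qed
  also have "\<dots> = (\<Sum>w\<in>S - {p} - {a}. \<Sum>m3\<in>pms (S - {p, a}).
      of_bool (joined (S - {p, a}) m m3) * f (insert {p, w} (swap a w m3)))"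
  proof (rule sum.cong[OF refl])
    fix w assume "w \<in> S - {p} - {a}"
    then show "(\<Sum>m2\<in>pms (S - {p, w}). of_bool (joined (S - {p, a}) m (swap a w m2)) * f (insert {p, w} m2))
      = (\<Sum>m3\<in>pms (S - {p, a}). of_bool (joined (S - {p, a}) m m3) * f (insert {p, w} (swap a w m3)))"
      using sum_pms_swap[of a "S - {p}" w
          "\<lambda>m2. of_bool (joined (S - {p, a}) m (swap a w m2)) * f (insert {p, w} m2)"] assms
      by (simp add: *)
  qed
  also have "\<dots> = ham (S - {p, a}) (move (S - {p}) (\<lambda>w m. f (insert {p, w} m)) a) m"
    unfolding ham_def move_def sum_distrib_left by (rule sum.swap)
  finally show ?thesis .
qed

section \<open>The degree and the norm of the graph\<close>

lemma joined_card2: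
  assumes "card S = 2" "x \<in> pms S" "y \<in> pms S"
  shows "joined S x y"
proof -
  obtain u v where uv: "S = {u, v}" "u \<noteq> v" using assms(1) by (meson card_2_iff)
  then have "{u, v} \<in> x" using pms_partner[OF assms(2), of u] by auto
  then show ?thesis using uv by (auto simp: joined_def insert_commute)
qed

text \<open>The degree is (2k)!!: each contraction contributes one factor, the number of choices for
  the new partner \<open>w\<close> of \<open>p\<close>.\<close>

lemma ham_const:
  assumes "finite S" "card S = 2 * (k + 1)" "x \<in> pms S"
  shows "ham S (\<lambda>_. r) x = r * (2 ^ k * fact k)"
  using assms
proof (induction k arbitrary: S x r)
  case 0
  then have "card (pms S) = 1" using card_pms[of S 1] by simp
  moreover have "ham S (\<lambda>_. r) x = (\<Sum>y\<in>pms S. r)"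
    unfolding ham_def using 0 by (intro sum.cong refl) (simp add: joined_card2)
  ultimately show ?case by simp
next
  case (Suc k)
  then obtain p where p: "p \<in> S" by fastforce
  obtain a where a: "a \<in> S - {p}" "{p, a} \<in> x" using pms_partner[OF Suc.prems(3) p] by blast
  then have x: "x = insert {p, a} (x - {{p, a}})" by blast
  have m: "x - {{p, a}} \<in> pms (S - {p, a})" using remove_edge_pms[OF Suc.prems(3) a(2)] .
  have "card (S - {p, a}) = 2 * (k + 1)" "card (S - {p} - {a}) = 2 * (k + 1)"
    using Suc.prems p a by (auto simp: card_Diff_subset)
  then have "move (S - {p}) (\<lambda>_ _. r) a = (\<lambda>_. r * (2 * (real k + 1)))"
    by (simp add: move_def fun_eq_iff)
  then have "ham S (\<lambda>_. r) x = ham (S - {p, a}) (\<lambda>_. r * (2 * (real k + 1))) (x - {{p, a}})"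
    using ham_insert[OF Suc.prems(1) _ p a(1) m, of "\<lambda>_. r"] x Suc.prems by simp
  also have "\<dots> = r * (2 * (real k + 1)) * (2 ^ k * fact k)"
    using Suc.prems m \<open>card (S - {p, a}) = _\<close> by (intro Suc.IH) auto
  finally show ?case by (simp add: algebra_simps)
qed

text \<open>The graph is undirected and regular, so summing over \<open>x\<close> first leaves the
  degree as a factor; in particular sum zero is preserved.\<close>

lemma sum_ham:
  assumes "finite S" "card S = 2 * (k + 1)"
  shows "(\<Sum>x\<in>pms S. ham S f x) = 2 ^ k * fact k * (\<Sum>x\<in>pms S. f x)"
proof -
  have "(\<Sum>x\<in>pms S. ham S f x) = (\<Sum>y\<in>pms S. ham S (\<lambda>_. f y) y)"
    unfolding ham_def by (subst sum.swap) (simp add: joined_commute[of S])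
  also have "\<dots> = (\<Sum>y\<in>pms S. f y * (2 ^ k * fact k))"
    using assms by (intro sum.cong refl ham_const)
  also have "\<dots> = 2 ^ k * fact k * (\<Sum>x\<in>pms S. f x)"
    by (simp only: sum_distrib_left mult.commute[of _ "2 ^ k * fact k"])
  finally show ?thesis .
qed

text \<open>Split \<open>f\<close> into its mean \<open>u a\<close> over the matchings containing
  \<open>{p, a}\<close> and the deviation \<open>f0\<close>. The operator respects the two
  orthogonal parts and has the bound \<open>d\<close> on each of them.\<close>

lemma ham_norm:
  assumes "finite S" "card S = 2 * (k + 2)" "(\<Sum>x\<in>pms S. f x) = 0"
  shows "(\<Sum>x\<in>pms S. (ham S f x)\<^sup>2) \<le> (2 ^ k * fact k)\<^sup>2 * (\<Sum>x\<in>pms S. (f x)\<^sup>2)"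
  using assms
proof (induction k arbitrary: S f rule: less_induct)
  case (less k)
  note fin = less.prems(1) and card = less.prems(2) and f = less.prems(3)
  define d where "d = (2 ^ k * fact k :: real)"
  from card obtain p where p: "p \<in> S" by fastforce
  define T where "T = S - {p}"
  have T: "finite T" "card T = 2 * (k + 1) + 1" using fin card p by (auto simp: T_def)
  have S_T: "S - {p, a} = T - {a}" for a by (auto simp: T_def)
  have cardT: "card (T - {a}) = 2 * (k + 1)" if "a \<in> T" for a using T that by simp
  define \<mu> where "\<mu> = real (double_fact (2 * (k + 1) - 1))"
  have \<mu>: "\<mu> > 0" by (simp add: \<mu>_def double_fact_pos)
  have card_link: "real (card (pms (T - {a}))) = \<mu>" if "a \<in> T" for a
    unfolding \<mu>_def using T that by (subst card_pms[where k = "k + 1"]) auto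
  define u where "u a = (\<Sum>m\<in>pms (T - {a}). f (insert {p, a} m)) / \<mu>" for a
  define f0 where "f0 a m = f (insert {p, a} m) - u a" for a m
  have f_eq: "f (insert {p, a} m) = f0 a m + u a" for a m by (simp add: f0_def)
  have sum_S: "(\<Sum>x\<in>pms S. \<phi> x) = near_sum T (\<lambda>a m. \<phi> (insert {p, a} m))" for \<phi> :: "'a set set \<Rightarrow> real"
    unfolding near_sum_def using sum_pms_partner[OF fin p, of \<phi>] by (simp add: S_T flip: T_def)
  have f0: "(\<Sum>m\<in>pms (T - {a}). f0 a m) = 0" if "a \<in> T" for a
    using card_link[OF that] \<mu> by (simp add: f0_def sum_subtractf u_def)
  have u: "(\<Sum>a\<in>T. u a) = 0"
    using f unfolding sum_S by (simp add: near_sum_def u_def flip: sum_divide_distrib)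
  define h where "h a m = ham (T - {a}) (move T f0 a) m" for a m
  have h: "(\<Sum>m\<in>pms (T - {a}). h a m) = 0" if "a \<in> T" for a
    unfolding h_def using that T sum_move_zero[OF T(1) that f0] by (subst sum_ham[where k = k]) auto
  \<comment> \<open>On the mean part, moving turns \<open>u a\<close> into \<open>- u a\<close>
    because \<open>u\<close> has sum zero, and the smaller graph then multiplies by its degree
    \<open>d\<close>.\<close>
  have ham_eq: "ham S f (insert {p, a} m) = h a m - d * u a" if "a \<in> T" "m \<in> pms (T - {a})" for a m
  proof -
    have "(\<Sum>w\<in>T - {a}. u w) = - u a" using u T that by (simp add: sum_diff1)
    then have "move T (\<lambda>w m. f (insert {p, w} m)) a = (\<lambda>m. move T f0 a m - u a)"
      by (simp add: fun_eq_iff move_def f_eq sum.distrib)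
    then have "ham S f (insert {p, a} m) = ham (T - {a}) (\<lambda>m. move T f0 a m - u a) m"
      using ham_insert[OF fin _ p, of a m f] card that by (simp add: S_T flip: T_def)
    also have "\<dots> = h a m - ham (T - {a}) (\<lambda>_. u a) m" by (simp add: ham_diff h_def)
    also have "ham (T - {a}) (\<lambda>_. u a) m = u a * d"
      unfolding d_def using T that by (intro ham_const) auto
    finally show ?thesis by simp
  qed
  \<comment> \<open>For \<open>k = 0\<close> each \<open>T - {a}\<close> has two vertices and the
    deviation is zero. For \<open>k = Suc j\<close> the smaller graph contributes
    \<open>2 ^ j * fact j\<close> and the move \<open>2 * k\<close>, with product
    \<open>d\<close>.\<close>
  have h_norm: "near_sum T (\<lambda>a m. (h a m)\<^sup>2) \<le> d\<^sup>2 * near_sum T (\<lambda>a m. (f0 a m)\<^sup>2)"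
  proof (cases k)
    case 0
    have "f0 a m = 0" if "a \<in> T" "m \<in> pms (T - {a})" for a m
      using pms_card2_zero[of "T - {a}" "f0 a" m] that T f0 0 by simp
    moreover have "swap a w m \<in> pms (T - {w})" if "a \<in> T" "w \<in> T" "m \<in> pms (T - {a})" for a w m
      using bij_betwE[OF bij_betw_swap[OF that(1,2)]] that(3) by blast
    ultimately have "move T f0 a m = 0" if "a \<in> T" "m \<in> pms (T - {a})" for a m
      using that by (simp add: move_def)
    then have "near_sum T (\<lambda>a m. (h a m)\<^sup>2) = near_sum T (\<lambda>a m. 0)"
      by (intro near_sum_cong) (simp add: h_def ham_def)
    then show ?thesis by (simp add: near_sum_def sum_nonneg)
  next
    case (Suc j)
    have "near_sum T (\<lambda>a m. (h a m)\<^sup>2)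
      \<le> (2 ^ j * fact j)\<^sup>2 * near_sum T (\<lambda>a m. (move T f0 a m)\<^sup>2)"
      unfolding near_sum_def sum_distrib_left[of _ _ T] h_def
      using Suc T f0 by (intro sum_mono less.IH sum_move_zero) auto
    also have "\<dots> \<le> (2 ^ j * fact j)\<^sup>2 * ((2 * real (k + 1) - 2)\<^sup>2 * near_sum T (\<lambda>a m. (f0 a m)\<^sup>2))"
      using Suc T f0 by (intro mult_left_mono move_norm) auto
    also have "\<dots> = d\<^sup>2 * near_sum T (\<lambda>a m. (f0 a m)\<^sup>2)"
    proof -
      have "d = 2 ^ j * fact j * (2 * real (k + 1) - 2)" by (simp add: d_def Suc algebra_simps)
      then show ?thesis by (simp only: power_mult_distrib mult.assoc)
    qed
    finally show ?thesis .
  qed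
  \<comment> \<open>Pythagoras, for a function orthogonal to all functions of \<open>a\<close>
    alone.\<close>
  have split: "near_sum T (\<lambda>a m. (g a m + r * u a)\<^sup>2)
      = near_sum T (\<lambda>a m. (g a m)\<^sup>2) + r\<^sup>2 * near_sum T (\<lambda>a m. (u a)\<^sup>2)"
    if "\<And>a. a \<in> T \<Longrightarrow> (\<Sum>m\<in>pms (T - {a}). g a m) = 0" for g r
  proof -
    have "near_sum T (\<lambda>a m. g a m * u a) = 0"
      unfolding near_sum_def by (rule sum.neutral) (simp add: that flip: sum_distrib_right)
    moreover have "near_sum T (\<lambda>a m. (g a m + r * u a)\<^sup>2)
      = near_sum T (\<lambda>a m. (g a m)\<^sup>2 + r\<^sup>2 * (u a)\<^sup>2 + 2 * r * (g a m * u a))"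
      by (intro near_sum_cong) (simp add: power2_eq_square algebra_simps)
    ultimately show ?thesis by (simp only: near_sum_add near_sum_cmult)
  qed
  have "(\<Sum>x\<in>pms S. (ham S f x)\<^sup>2) = near_sum T (\<lambda>a m. (h a m + (- d) * u a)\<^sup>2)"
    unfolding sum_S by (intro near_sum_cong) (simp add: ham_eq)
  also have "\<dots> = near_sum T (\<lambda>a m. (h a m)\<^sup>2) + d\<^sup>2 * near_sum T (\<lambda>a m. (u a)\<^sup>2)"
    using split[OF h, where r = "- d"] by simp
  also have "\<dots> \<le> d\<^sup>2 * (near_sum T (\<lambda>a m. (f0 a m)\<^sup>2) + near_sum T (\<lambda>a m. (u a)\<^sup>2))"
    using h_norm by (simp add: algebra_simps)
  also have "near_sum T (\<lambda>a m. (f0 a m)\<^sup>2) + near_sum T (\<lambda>a m. (u a)\<^sup>2) = (\<Sum>x\<in>pms S. (f x)\<^sup>2)"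
    unfolding sum_S f_eq using split[OF f0, where r = 1] by simp
  finally show ?case by (simp add: d_def)
qed

section \<open>The ratio bound and the extremal family\<close>

lemma card_not_joined_le:
  assumes S: "finite S" "card S = 2 * (k + 2)"
    and F: "F \<subseteq> pms S" "\<And>x y. x \<in> F \<Longrightarrow> y \<in> F \<Longrightarrow> \<not> joined S x y"
  shows "card F \<le> double_fact (2 * k + 1)"
proof (cases "F = {}")
  case False
  define N where "N = real (card (pms S))"
  define \<alpha> where "\<alpha> = real (card F) / N"
  define r where "r = (2 ^ k * fact k :: real)"
  define d where "d = (2 ^ Suc k * fact (Suc k) :: real)"
  have fin: "finite (pms S)" "finite F" using S F finite_pms finite_subset by blast+
  have F_pos: "real (card F) > 0" using False fin by (simp add: card_gt_0_iff)
  have N: "N = (2 * real k + 3) * real (double_fact (2 * k + 1))"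
  proof -
    have "N = real (double_fact (2 * (k + 2) - 1))" unfolding N_def using card_pms[OF S] by simp
    also have "2 * (k + 2) - 1 = Suc (Suc (2 * k + 1))" by simp
    finally show ?thesis by (simp add: algebra_simps)
  qed
  then have N_pos: "N > 0" by (simp add: double_fact_pos)
  define f where "f x = of_bool (x \<in> F) - \<alpha>" for x
  define g where "g = ham S f"
  have sum_F: "(\<Sum>x\<in>pms S. of_bool (x \<in> F) * \<phi> x) = (\<Sum>x\<in>F. \<phi> x)" for \<phi> :: "'a set set \<Rightarrow> real"
    using fin F by (intro sum.mono_neutral_cong_right) auto
  have sum_f: "(\<Sum>x\<in>pms S. f x) = 0"
    using sum_F[of "\<lambda>_. 1"] N_pos by (simp add: f_def sum_subtractf \<alpha>_def flip: N_def)
  have sum_g: "(\<Sum>x\<in>pms S. g x) = 0"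
    unfolding g_def using S by (subst sum_ham[where k = "Suc k"]) (auto simp: sum_f)
  \<comment> \<open>A member of \<open>F\<close> has no neighbour in \<open>F\<close>, so only the
    constant \<open>\<alpha>\<close> contributes, multiplied by the degree.\<close>
  have g_F: "g x = - \<alpha> * d" if "x \<in> F" for x
  proof -
    have "ham S (\<lambda>y. of_bool (y \<in> F)) x = 0"
      unfolding ham_def using F(2)[OF that] by (intro sum.neutral) auto
    moreover have "ham S (\<lambda>_. \<alpha>) x = \<alpha> * d"
      unfolding d_def using S F that by (intro ham_const) auto
    ultimately show ?thesis by (simp add: g_def f_def[abs_def] ham_diff)
  qed
  have fg: "(\<Sum>x\<in>pms S. f x * g x) = - real (card F) * \<alpha> * d"
  proof -
    have "(\<Sum>x\<in>pms S. f x * g x) = (\<Sum>x\<in>F. g x) - \<alpha> * (\<Sum>x\<in>pms S. g x)"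
      by (simp add: f_def left_diff_distrib sum_subtractf sum_F sum_distrib_left)
    then show ?thesis by (simp add: sum_g g_F)
  qed
  have ff: "(\<Sum>x\<in>pms S. (f x)\<^sup>2) = real (card F) * (1 - \<alpha>)"
  proof -
    have "(\<Sum>x\<in>pms S. (f x)\<^sup>2) = (\<Sum>x\<in>pms S. (of_bool (x \<in> F) - \<alpha>) * f x)"
      by (simp add: f_def power2_eq_square)
    also have "\<dots> = (\<Sum>x\<in>F. f x) - \<alpha> * (\<Sum>x\<in>pms S. f x)"
      by (simp add: left_diff_distrib sum_subtractf sum_F sum_distrib_left)
    also have "(\<Sum>x\<in>F. f x) = real (card F) * (1 - \<alpha>)" by (simp add: f_def)
    finally show ?thesis by (simp add: sum_f)
  qed
  have gg: "(\<Sum>x\<in>pms S. (g x)\<^sup>2) \<le> r\<^sup>2 * (\<Sum>x\<in>pms S. (f x)\<^sup>2)"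
    unfolding g_def r_def by (rule ham_norm[OF S sum_f])
  \<comment> \<open>With the norm bound, this square yields that the form of \<open>f\<close> is at
    least \<open>- r\<close> times its squared norm, without any eigenvectors.\<close>
  have "0 \<le> (\<Sum>x\<in>pms S. (g x + r * f x)\<^sup>2)" by (simp add: sum_nonneg)
  also have "\<dots> = (\<Sum>x\<in>pms S. (g x)\<^sup>2) + 2 * r * (\<Sum>x\<in>pms S. f x * g x) + r\<^sup>2 * (\<Sum>x\<in>pms S. (f x)\<^sup>2)"
    by (simp add: power2_eq_square algebra_simps sum.distrib sum_distrib_left)
  also have "\<dots> \<le> 2 * r * (r * (real (card F) * (1 - \<alpha>)) - real (card F) * \<alpha> * d)"
    using gg unfolding ff fg by (simp add: power2_eq_square[of r] algebra_simps)
  \<comment> \<open>The degree \<open>d\<close> is \<open>2 * (k + 1) * r\<close>, so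
    \<open>\<alpha>\<close> gets the coefficient \<open>2 * k + 3\<close>, the same factor as in
    \<open>N\<close>.\<close>
  also have "\<dots> = 2 * r\<^sup>2 * real (card F) * (1 - \<alpha> * (2 * real k + 3))"
    by (simp add: d_def r_def power2_eq_square algebra_simps)
  finally have "0 \<le> 2 * r\<^sup>2 * real (card F) * (1 - \<alpha> * (2 * real k + 3))" .
  moreover have "2 * r\<^sup>2 * real (card F) > 0" using F_pos by (simp add: r_def)
  ultimately have "\<alpha> * (2 * real k + 3) \<le> 1" by (simp only: zero_le_mult_iff) linarith
  then have "real (card F) * (2 * real k + 3) \<le> N"
    using N_pos by (simp add: \<alpha>_def divide_simps)
  then have "(2 * real k + 3) * real (card F) \<le> (2 * real k + 3) * real (double_fact (2 * k + 1))"
    unfolding N by (simp only: mult.commute)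
  then have "real (card F) \<le> real (double_fact (2 * k + 1))"
    by (subst (asm) mult_le_cancel_left_pos) auto
  then show ?thesis by simp
qed simp

theorem theorem5p3:
  fixes n :: nat
  assumes "n \<ge> 2"
  shows "(\<forall>\<F>. disconnected_matching_family n \<F> \<longrightarrow> card \<F> \<le> double_fact (2 * (n - 1) - 1)) \<and>
         (\<exists>\<F>. disconnected_matching_family n \<F> \<and> card \<F> = double_fact (2 * (n - 1) - 1))"
proof
  define S where "S = {1..2 * n}"
  obtain k where k: "n = k + 2" using assms by (metis add.commute le_Suc_ex)
  have df: "2 * (n - 1) - 1 = 2 * k + 1" by (simp add: k)
  have S: "finite S" "card S = 2 * (k + 2)" "S \<noteq> {}" by (auto simp: S_def k)
  have family_iff: "disconnected_matching_family n \<F> \<longleftrightarrow>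
      \<F> \<subseteq> pms S \<and> (\<forall>x\<in>\<F>. \<forall>y\<in>\<F>. \<not> joined S x y)" for \<F>
    using multigraph_connected_iff_joined[OF S(1,3)]
    unfolding disconnected_matching_family_def S_def[symmetric]
    by (simp add: pms_def subset_iff) blast
  show "\<forall>\<F>. disconnected_matching_family n \<F> \<longrightarrow> card \<F> \<le> double_fact (2 * (n - 1) - 1)"
    unfolding family_iff df using card_not_joined_le[OF S(1,2)] by blast
  have p: "1 \<in> S" "2 \<in> S" by (auto simp: S_def k)
  \<comment> \<open>The extremal family consists of all matchings through one fixed edge; the shared
    edge disconnects every union.\<close>
  define \<F> where "\<F> = insert {1, 2} ` pms (S - {1, 2})"
  have "inj_on (insert {1, 2}) (pms (S - {1, 2}))"
  proof (rule inj_onI)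
    fix x y assume "x \<in> pms (S - {1, 2})" "y \<in> pms (S - {1, 2})" "insert {1, 2} x = insert {1, 2} y"
    moreover from this have "{1, 2} \<notin> x" "{1, 2} \<notin> y" by (blast dest: pms_edge(1))+
    ultimately show "x = y" by (simp add: insert_ident)
  qed
  then have "card \<F> = card (pms (S - {1, 2}))" by (simp add: \<F>_def card_image)
  also have "\<dots> = double_fact (2 * (k + 1) - 1)"
    using S p by (intro card_pms) (auto simp: card_Diff_subset)
  finally have "card \<F> = double_fact (2 * (n - 1) - 1)" by (simp add: k)
  moreover have "disconnected_matching_family n \<F>"
    unfolding family_iff \<F>_def
    using insert_edge_pms[of 1 S 2] joined_common_edge[of S 1 2] p S by auto
  ultimately show "\<exists>\<F>. disconnected_matching_family n \<F> \<and> card \<F> = double_fact (2 * (n - 1) - 1)"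
    by blast
qed

end
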